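(* Let $\sigma\in[0,1)$, and define $\kappa:=\left(\frac{9}{410}\right)^2(1-\sigma^2)$. Then there exist constants $C',c>0$ such that for all $n\ge\frac{C'}{\kappa}\log n$ the following holds. Let $A,B\sim W(n,\sigma,\mathrm{id})$, and for any $X^{(0)}\in\mathcal{P}_n$ let $X^{(N)}$ denote the output of PPMGM (the projected power method for graph matching) with input matrices $\mathcal{H}(A),\mathcal{H}(B)$, initial point $X^{(0)}$ and $N=\lceil 2\log n\rceil$ iterations. Then $$\mathbb{P}\Big(\forall X^{(0)}\in\mathcal{P}_n\text{ such that }|S_{X^{(0)}}|\ge(1-\kappa)n:\ X^{(N)}=\mathrm{Id}\Big)\ge 1-e^{-c\kappa n}-3n^{-2}.$$
   Context: $\mathcal{P}_n$ is the set of $n\times n$ permutation matrices, $\mathrm{Id}$ the identity matrix; for $X\in\mathcal{P}_n$, $S_X=\{i\in[n]:X_{ii}=1\}$. For a square matrix $M$, $\mathcal{H}(M)$ is $M$ with its diagonal removed (diagonal entries replaced by $0$). Correlated Gaussian Wigner model $W(n,\sigma,\mathrm{id})$, $\sigma\in[0,1)$: $A$ is a symmetric random $n\times n$ matrix whose entries $(A_{ij})_{i\le j}$ are independent with $A_{ij}\sim\mathcal{N}(0,\frac1n)$ for $i<j$ and $A_{ii}\sim\mathcal{N}(0,\frac2n)$; $Z$ is an independent copy of $A$; and $B_{ij}=\sqrt{1-\sigma^2}\,A_{ij}+\sigma Z_{ij}$ for all $i,j$. GMWM (greedy maximum weight matching), denoted $\tau$: given $C\in\mathbb{R}^{n\times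 n}$, select $(i_1,j_1)$ such that $C_{i_1j_1}$ is the largest entry of $C$ (ties broken arbitrarily), discard row $i_1$ and column $j_1$, select the largest entry $(i_2,j_2)$ among the remaining ones, and so on for $n$ steps; $\tau(C)\in\mathcal{P}_n$ is the permutation matrix with ones exactly at $(i_1,j_1),\dots,(i_n,j_n)$. PPMGM with inputs $A,B$, initial point $X^{(0)}$ and $N$ iterations computes $X^{(k+1)}=\tau(AX^{(k)}B)$ for $k=0,\dots,N-1$ and outputs $X^{(N)}$. *)

theory Defs
  imports
    "HOL-Probability.Probability"
    "HOL-Combinatorics.Permutations"
    "Jordan_Normal_Form.Matrix"
begin

definition permutation_mats :: "nat \<Rightarrow> real mat set" where
  "permutation_mats n =
     {mat n n (\<lambda>(i, j). if j = p i then 1 else 0) | p. p permutes {..<n}}"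

definition fixed_points :: "real mat \<Rightarrow> nat set" where
  "fixed_points X = {i. i < dim_row X \<and> X $$ (i, i) = 1}"

definition off_diagonal :: "real mat \<Rightarrow> real mat" where
  "off_diagonal M =
     mat (dim_row M) (dim_col M) (\<lambda>(i, j). if i = j then 0 else M $$ (i, j))"

definition remaining :: "nat \<Rightarrow> (nat \<times> nat) list \<Rightarrow> (nat \<times> nat) set" where
  "remaining n ps = {(i, j). i < n \<and> j < n \<and> i \<notin> fst ` set ps \<and> j \<notin> snd ` set ps}"

inductive greedy_selection :: "real mat \<Rightarrow> (nat \<times> nat) list \<Rightarrow> bool" for C where
  greedy_Nil: "greedy_selection C []"
| greedy_snoc: "greedy_selection C ps \<Longrightarrow> q \<in> remaining (dim_row C) ps \<Longrightarrow>
    (\<forall>r \<in> remaining (dim_row C) ps. C $$ r \<le> C $$ q) \<Longrightarrow>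
    greedy_selection C (ps @ [q])"

(* Ties may be broken in any way, so GMWM and PPMGM are set-valued: they return the set of
   all results reachable under some choice among the maximal entries at each step. *)

definition gmwm :: "real mat \<Rightarrow> real mat set" where
  "gmwm C = {mat (dim_row C) (dim_row C) (\<lambda>q. if q \<in> set ps then 1 else 0) | ps.
     greedy_selection C ps \<and> length ps = dim_row C}"

primrec ppmgm :: "real mat \<Rightarrow> real mat \<Rightarrow> real mat \<Rightarrow> nat \<Rightarrow> real mat set" where
  "ppmgm A B X0 0 = {X0}"
| "ppmgm A B X0 (Suc k) = (\<Union>X \<in> ppmgm A B X0 k. gmwm (A * X * B))"

lemma finite_remaining: "finite (remaining n ps)"
  by (rule finite_subset[of _ "{..<n} \<times> {..<n}"]) (auto simp: remaining_def)

lemma remaining_nonempty: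
  assumes "length ps < n"
  shows "remaining n ps \<noteq> {}"
proof -
  have "card (fst ` set ps) < n" "card (snd ` set ps) < n"
    using assms card_image_le[of "set ps" fst] card_image_le[of "set ps" snd] card_length[of ps]
    by auto
  then have "\<not> {..<n} \<subseteq> fst ` set ps" "\<not> {..<n} \<subseteq> snd ` set ps"
    by (metis List.finite_set card_lessThan card_mono finite_imageI leD)+
  then show ?thesis by (auto simp: remaining_def)
qed

lemma gmwm_nonempty: "gmwm C \<noteq> {}"
proof -
  have "\<exists>ps. greedy_selection C ps \<and> length ps = k" if "k \<le> dim_row C" for k
    using that
  proof (induction k)
    case 0
    then show ?case using greedy_Nil by auto
  next
    case (Suc k)
    then obtain ps where ps: "greedy_selection C ps" "length ps = k" by auto
    let ?R = "remaining (dim_row C) ps"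
    have R: "finite ((\<lambda>r. C $$ r) ` ?R)" "?R \<noteq> {}"
      using finite_remaining remaining_nonempty ps Suc.prems by auto
    then obtain q where q: "q \<in> ?R" "C $$ q = Max ((\<lambda>r. C $$ r) ` ?R)"
      using Max_in[OF R(1)] by (metis (mono_tags, lifting) imageE image_is_empty)
    then have "\<forall>r \<in> ?R. C $$ r \<le> C $$ q" using Max_ge[OF R(1)] by auto
    then have "greedy_selection C (ps @ [q])" using greedy_snoc ps(1) q(1) by blast
    then show ?case using ps(2) by (intro exI[of _ "ps @ [q]"]) simp
  qed
  then show ?thesis unfolding gmwm_def by blast
qed

lemma ppmgm_nonempty: "ppmgm A B X0 k \<noteq> {}"
  by (induction k) (auto simp: gmwm_nonempty)

definition upper_indices :: "nat \<Rightarrow> (nat \<times> nat) set" where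
  "upper_indices n = {(i, j). i \<le> j \<and> j < n}"

context prob_space
begin

(* normal_density takes the standard deviation, not the variance. *)
definition gaussian_wigner :: "nat \<Rightarrow> ('a \<Rightarrow> real mat) \<Rightarrow> bool" where
  "gaussian_wigner n A \<longleftrightarrow>
     (\<forall>\<omega> \<in> space M. A \<omega> \<in> carrier_mat n n \<and> transpose_mat (A \<omega>) = A \<omega>) \<and>
     indep_vars (\<lambda>_. borel) (\<lambda>q \<omega>. A \<omega> $$ q) (upper_indices n) \<and>
     (\<forall>i j. i < j \<and> j < n \<longrightarrow>
        distributed M lborel (\<lambda>\<omega>. A \<omega> $$ (i, j)) (normal_density 0 (sqrt (1 / real n)))) \<and>
     (\<forall>i < n.
        distributed M lborel (\<lambda>\<omega>. A \<omega> $$ (i, i)) (normal_density 0 (sqrt (2 / real n))))"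

definition correlated_gaussian_wigner ::
  "nat \<Rightarrow> real \<Rightarrow> ('a \<Rightarrow> real mat) \<Rightarrow> ('a \<Rightarrow> real mat) \<Rightarrow> bool" where
  "correlated_gaussian_wigner n \<sigma> A B \<longleftrightarrow>
     gaussian_wigner n A \<and>
     (\<exists>Z. gaussian_wigner n Z \<and>
        indep_var
          (PiM (upper_indices n) (\<lambda>_. borel)) (\<lambda>\<omega>. \<lambda>q \<in> upper_indices n. A \<omega> $$ q)
          (PiM (upper_indices n) (\<lambda>_. borel)) (\<lambda>\<omega>. \<lambda>q \<in> upper_indices n. Z \<omega> $$ q) \<and>
        (\<forall>\<omega> \<in> space M. B \<omega> = sqrt (1 - \<sigma>\<^sup>2) \<cdot>\<^sub>m A \<omega> + \<sigma> \<cdot>\<^sub>m Z \<omega>))"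

end

end

theory Submission
  imports Defs
begin

text \<open>
  A single step already recovers the identity. Write \<open>\<rho> = sqrt (1 - \<sigma>\<^sup>2)\<close>, let \<open>a, b\<close> be the
  off-diagonal parts of the two matrices and let \<open>X\<close> be the matrix of a permutation \<open>p\<close> displacing
  the set \<open>T\<close>. The entry of \<open>a X b\<close> at \<open>(i, j)\<close> differs from that of \<open>a b\<close> by
  \<open>\<Sum>k\<in>T. a i k * (b (p k) j - b k j)\<close>, which AM-GM bounds by the sum over \<open>T\<close> of the squares in row \<open>i\<close>
  of \<open>a\<close> and column \<open>j\<close> of \<open>b\<close>. As \<open>T\<close> has at most \<open>\<kappa> n\<close> elements and \<open>\<kappa>\<close> is small compared to
  \<open>\<rho>\<close>, these sums are uniformly at most a small multiple of \<open>\<rho>\<close> with high probability. On the other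
  hand \<open>a b\<close> has diagonal close to \<open>\<rho>\<close> and small off-diagonal entries. So every diagonal entry of
  \<open>a X b\<close> is the strict maximum of its row, which forces the greedy matching to be the identity. All
  exceptional probabilities are exponentially small in \<open>\<rho>\<^sup>2 n\<close> by Chernoff bounds, and the
  polynomial number of events is absorbed by the assumption \<open>n \<ge> C' / \<kappa> * ln n\<close>.
\<close>

section \<open>Gaussian exponential moments\<close>

lemma nn_integral_normal_density:
  assumes "0 < s"
  shows "(\<integral>\<^sup>+x. normal_density m s x \<partial>lborel) = 1"
proof -
  interpret prob_space "density lborel (normal_density m s)"
    using assms by (rule prob_space_normal_density)
  show ?thesis using emeasure_space_1 by (simp add: emeasure_density)
qed

text \<open>Completing the square: the exponentially tilted density is
  \<open>exp (a\<^sup>2 / 2)\<close> times the normal density with mean \<open>a\<close> and unit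
  variance.\<close>

lemma nn_integral_std_normal_exp:
  "(\<integral>\<^sup>+x. ennreal (std_normal_density x) * ennreal (exp (a * x)) \<partial>lborel) = ennreal (exp (a\<^sup>2 / 2))"
proof -
  have "std_normal_density x * exp (a * x) = exp (a\<^sup>2 / 2) * normal_density a 1 x" for x
    by (simp add: normal_density_def field_simps flip: exp_add)
       (simp add: power2_eq_square field_simps)
  then have "ennreal (std_normal_density x) * ennreal (exp (a * x)) =
      ennreal (exp (a\<^sup>2 / 2)) * ennreal (normal_density a 1 x)" for x
    by (simp flip: ennreal_mult')
  then show ?thesis
    by (simp add: nn_integral_cmult nn_integral_normal_density)
qed

text \<open>The factor only changes the variance: the integrand is \<open>s\<close> times the
  centred normal density of standard deviation \<open>s = 1 / sqrt (1 - 2 * a)\<close>, which is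
  meaningful because \<open>a < 1 / 2\<close>.\<close>

lemma nn_integral_std_normal_exp_square:
  assumes "a < 1 / 2"
  shows "(\<integral>\<^sup>+x. ennreal (std_normal_density x) * ennreal (exp (a * x\<^sup>2)) \<partial>lborel) =
    ennreal (1 / sqrt (1 - 2 * a))"
proof -
  define s where "s = 1 / sqrt (1 - 2 * a)"
  have s: "0 < s" "s\<^sup>2 = 1 / (1 - 2 * a)"
    using assms by (auto simp: s_def power_divide)
  have "std_normal_density x * exp (a * x\<^sup>2) = s * normal_density 0 s x" for x
  proof -
    have "exp (- (x\<^sup>2 / 2)) * exp (a * x\<^sup>2) = exp (- (x\<^sup>2 / (2 * s\<^sup>2)))"
    proof -
      have "- (x\<^sup>2 / 2) + a * x\<^sup>2 = - (x\<^sup>2 / (2 * s\<^sup>2))"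
        unfolding s(2) by (simp add: field_simps)
      then show ?thesis by (simp flip: exp_add)
    qed
    moreover have "sqrt (2 * pi * s\<^sup>2) = s * sqrt (2 * pi)"
      using s(1) by (simp add: real_sqrt_mult)
    ultimately show ?thesis using s(1) by (simp add: normal_density_def)
  qed
  then have "ennreal (std_normal_density x) * ennreal (exp (a * x\<^sup>2)) =
      ennreal s * ennreal (normal_density 0 s x)" for x
    using s(1) by (simp flip: ennreal_mult')
  then show ?thesis
    using s(1) by (simp add: nn_integral_cmult nn_integral_normal_density flip: s_def)
qed

text \<open>Combines \<open>1 + x \<le> exp x\<close> with
  \<open>1 \<le> (1 - x) * (1 + x)\<^sup>2\<close>; the latter is
  \<open>0 \<le> x * (1 - x - x\<^sup>2)\<close>, true up to \<open>x = 1 / 2\<close>. It turns the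
  moment of a chi-square type variable into a clean exponential.\<close>

lemma inverse_sqrt_le_exp:
  fixes x :: real
  assumes "0 \<le> x" "x \<le> 1 / 2"
  shows "1 / sqrt (1 - x) \<le> exp x"
proof -
  have "exp (- x) \<le> 1 / (1 + x)"
    using exp_ge_add_one_self[of x] assms by (simp add: exp_minus field_simps)
  then have "exp (- (2 * x)) \<le> (1 / (1 + x))\<^sup>2"
    using power_mono[of "exp (- x)" "1 / (1 + x)" 2] by (simp flip: exp_of_nat_mult)
  also have "\<dots> \<le> 1 - x"
  proof -
    have "x * (1 - x - x\<^sup>2) \<ge> 0"
      using assms power_mono[of x "1/2" 2] by (intro mult_nonneg_nonneg) (auto simp: power2_eq_square)
    then have "1 \<le> (1 - x) * (1 + x)\<^sup>2" by (simp add: power2_eq_square algebra_simps)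
    then show ?thesis using assms by (simp add: power_divide divide_le_eq)
  qed
  finally have "sqrt (exp (- (2 * x))) \<le> sqrt (1 - x)" by simp
  moreover have "sqrt (exp (- (2 * x))) = exp (- x)"
    by (rule real_sqrt_unique) (simp_all flip: exp_of_nat_mult)
  ultimately have "exp (- x) \<le> sqrt (1 - x)" by simp
  then show ?thesis using assms by (simp add: exp_minus field_simps)
qed

context prob_space
begin

section \<open>Independence and Chernoff bounds\<close>

text \<open>Injectivity makes the singleton blocks \<open>{f k}\<close> disjoint, so independence
  passes to them and then to their only coordinates.\<close>

lemma indep_vars_reindex_inj:
  assumes ind: "indep_vars M' X I" and f: "inj_on f K" "f ` K \<subseteq> I"
  shows "indep_vars (\<lambda>k. M' (f k)) (\<lambda>k. X (f k)) K"
proof -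
  have "indep_vars (\<lambda>k. PiM {f k} M') (\<lambda>k \<omega>. \<lambda>i\<in>{f k}. X i \<omega>) K"
    using f by (intro indep_vars_restrict[OF ind]) (auto simp: disjoint_family_on_def inj_on_def)
  then have "indep_vars (\<lambda>k. M' (f k)) (\<lambda>k \<omega>. (\<lambda>v. v (f k)) (\<lambda>i\<in>{f k}. X i \<omega>)) K"
    by (rule indep_vars_compose2) auto
  then show ?thesis by simp
qed

text \<open>The blocks \<open>{u k, v k}\<close> are pairwise disjoint, and functions of disjoint
  blocks of an independent family are independent. This serves the products that occur in inner
  products of two rows.\<close>

lemma indep_vars_pairs:
  fixes X :: "'i \<Rightarrow> 'a \<Rightarrow> 'b :: topological_space" and h :: "'b \<Rightarrow> 'b \<Rightarrow> 'c :: topological_space"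
  assumes ind: "indep_vars (\<lambda>_. borel) X I"
    and u: "inj_on u K" "u ` K \<subseteq> I" and v: "inj_on v K" "v ` K \<subseteq> I"
    and uv: "u ` K \<inter> v ` K = {}"
    and h: "case_prod h \<in> borel_measurable (borel \<Otimes>\<^sub>M borel)"
  shows "indep_vars (\<lambda>_. borel) (\<lambda>k \<omega>. h (X (u k) \<omega>) (X (v k) \<omega>)) K"
proof -
  have "indep_vars (\<lambda>k. PiM {u k, v k} (\<lambda>_. borel)) (\<lambda>k \<omega>. \<lambda>i\<in>{u k, v k}. X i \<omega>) K"
  proof (rule indep_vars_restrict[OF ind])
    show "{u k, v k} \<subseteq> I" if "k \<in> K" for k using that u v by blast
    have "u k \<noteq> v l" if "k \<in> K" "l \<in> K" for k l using that uv by blast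
    then show "disjoint_family_on (\<lambda>k. {u k, v k}) K"
      using u(1) v(1) unfolding disjoint_family_on_def inj_on_def
      by (metis Int_emptyI insertE singletonD)
  qed
  then have "indep_vars (\<lambda>_. borel)
      (\<lambda>k \<omega>. (\<lambda>w. case_prod h (w (u k), w (v k))) (\<lambda>i\<in>{u k, v k}. X i \<omega>)) K"
  proof (rule indep_vars_compose2)
    fix k
    have "(\<lambda>w. (w (u k), w (v k))) \<in> PiM {u k, v k} (\<lambda>_. borel) \<rightarrow>\<^sub>M (borel \<Otimes>\<^sub>M borel)"
      by (intro measurable_Pair measurable_component_singleton) auto
    then show "(\<lambda>w. case_prod h (w (u k), w (v k))) \<in> borel_measurable (PiM {u k, v k} (\<lambda>_. borel))"
      by (rule measurable_compose[OF _ h])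
  qed
  then show ?thesis by simp
qed

lemma indep_var_of_indep_vars:
  assumes ind: "indep_vars (\<lambda>_. N) X I" and "i \<in> I" "j \<in> I" "i \<noteq> j"
  shows "indep_var N (X i) N (X j)"
proof -
  have "indep_vars (\<lambda>_. N) (\<lambda>b. X (case_bool i j b)) UNIV"
    using assms by (intro indep_vars_reindex_inj[OF ind]) (auto simp: inj_on_def split: bool.splits)
  then show ?thesis
    unfolding indep_var_def
    by (rule indep_vars_cong[THEN iffD1, rotated -1]) (auto split: bool.split)
qed

text \<open>Merges two families that are independent internally and of each other: the probability
  of a joint rectangle first splits into an \<open>X\<close> factor and a \<open>Y\<close> factor,
  and each of these splits over \<open>I\<close>.\<close>

lemma indep_vars_bool_Times:
  fixes X Y :: "'i \<Rightarrow> 'a \<Rightarrow> 'b"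
  assumes I: "finite I" "I \<noteq> {}"
    and X: "indep_vars (\<lambda>_. N) X I" and Y: "indep_vars (\<lambda>_. N) Y I"
    and XY: "indep_var (PiM I (\<lambda>_. N)) (\<lambda>\<omega>. \<lambda>i\<in>I. X i \<omega>) (PiM I (\<lambda>_. N)) (\<lambda>\<omega>. \<lambda>i\<in>I. Y i \<omega>)"
  shows "indep_vars (\<lambda>_. N) (\<lambda>(b, i). if b then Y i else X i) (UNIV \<times> I)"
proof -
  let ?W = "\<lambda>(b, i). if b then Y i else X i"
  have rv: "X i \<in> measurable M N" "Y i \<in> measurable M N" if "i \<in> I" for i
    using that X Y by (auto simp: indep_vars_def)
  have INT_bool_Times: "(\<Inter>l\<in>UNIV \<times> I. G l) = (\<Inter>i\<in>I. G (False, i)) \<inter> (\<Inter>i\<in>I. G (True, i))"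
    for G :: "bool \<times> 'i \<Rightarrow> 'a set"
    by (rule Set.set_eqI) (simp add: all_bool_eq conj_commute)
  \<comment> \<open>Each \<sigma>-algebra serves as its own intersection-stable generator, so only
    the product formula for measurable sets is left to check.\<close>
  show ?thesis
  proof (subst indep_vars_finite[where E = "\<lambda>_. sets N"])
    show "\<forall>S\<in>UNIV \<times> I \<rightarrow> sets N. prob (\<Inter>l\<in>UNIV \<times> I. ?W l -` S l \<inter> space M) =
        (\<Prod>l\<in>UNIV \<times> I. prob (?W l -` S l \<inter> space M))"
    proof
      fix S assume "S \<in> (UNIV :: bool set) \<times> I \<rightarrow> sets N"
      then have S: "S (b, i) \<in> sets N" if "i \<in> I" for b i using that by blast
      define A B where "A = Pi\<^sub>E I (\<lambda>i. S (False, i))" and "B = Pi\<^sub>E I (\<lambda>i. S (True, i))"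
      have AB: "A \<in> sets (PiM I (\<lambda>_. N))" "B \<in> sets (PiM I (\<lambda>_. N))"
        unfolding A_def B_def using S by (auto intro!: sets_PiM_I_finite I)
      \<comment> \<open>Here \<open>I \<noteq> {}\<close> matters: an intersection over the empty
        index set would be the whole type and not \<open>space M\<close>.\<close>
      have XA: "(\<lambda>\<omega>. \<lambda>i\<in>I. X i \<omega>) -` A \<inter> space M = (\<Inter>i\<in>I. X i -` S (False, i) \<inter> space M)"
        unfolding A_def using I(2) by (auto simp: PiE_iff)
      have YB: "(\<lambda>\<omega>. \<lambda>i\<in>I. Y i \<omega>) -` B \<inter> space M = (\<Inter>i\<in>I. Y i -` S (True, i) \<inter> space M)"
        unfolding B_def using I(2) by (auto simp: PiE_iff)
      have "(\<Inter>l\<in>UNIV \<times> I. ?W l -` S l \<inter> space M) =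
          (\<Inter>i\<in>I. X i -` S (False, i) \<inter> space M) \<inter> (\<Inter>i\<in>I. Y i -` S (True, i) \<inter> space M)"
        unfolding INT_bool_Times by simp
      also have "\<dots> = (\<lambda>\<omega>. (\<lambda>i\<in>I. X i \<omega>, \<lambda>i\<in>I. Y i \<omega>)) -` (A \<times> B) \<inter> space M"
        unfolding XA[symmetric] YB[symmetric] by blast
      also have "prob \<dots> = prob ((\<lambda>\<omega>. \<lambda>i\<in>I. X i \<omega>) -` A \<inter> space M) *
          prob ((\<lambda>\<omega>. \<lambda>i\<in>I. Y i \<omega>) -` B \<inter> space M)"
        by (rule indep_varD[OF XY AB])
      also have "\<dots> = (\<Prod>i\<in>I. prob (X i -` S (False, i) \<inter> space M)) *
          (\<Prod>i\<in>I. prob (Y i -` S (True, i) \<inter> space M))"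
        unfolding XA YB
        by (intro arg_cong2[where f = "(*)"] indep_varsD_finite[OF X] indep_varsD_finite[OF Y] I S)
      also have "\<dots> = (\<Prod>b\<in>UNIV. \<Prod>i\<in>I. prob (?W (b, i) -` S (b, i) \<inter> space M))"
        by (simp add: UNIV_bool)
      also have "\<dots> = (\<Prod>(b, i)\<in>UNIV \<times> I. prob (?W (b, i) -` S (b, i) \<inter> space M))"
        by (rule prod.cartesian_product)
      also have "\<dots> = (\<Prod>l\<in>UNIV \<times> I. prob (?W l -` S l \<inter> space M))"
        by (intro prod.cong) auto
      finally show "prob (\<Inter>l\<in>UNIV \<times> I. ?W l -` S l \<inter> space M) =
          (\<Prod>l\<in>UNIV \<times> I. prob (?W l -` S l \<inter> space M))" .
    qed
  next
    show "?W l \<in> measurable M N" if "l \<in> UNIV \<times> I" for l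
      using that rv by (cases l) auto
  next
    show "(UNIV :: bool set) \<times> I \<noteq> {}" "finite ((UNIV :: bool set) \<times> I)"
      using I by auto
  qed (simp_all only: sets.sigma_sets_eq sets.Int_stable sets.space_closed sets.top)
qed

text \<open>Markov's inequality for the exponential of the sum, whose expectation factorises by
  independence. The Chernoff parameter is fixed to 1, so callers scale \<open>Y\<close> beforehand;
  nonnegative integrals avoid integrability obligations.\<close>

lemma chernoff_bound:
  assumes "finite K" and ind: "indep_vars (\<lambda>_. borel) Y K"
    and mgf: "\<And>k. k \<in> K \<Longrightarrow> (\<integral>\<^sup>+\<omega>. ennreal (exp (Y k \<omega>)) \<partial>M) \<le> ennreal (exp c)"
  shows "prob {\<omega> \<in> space M. t \<le> (\<Sum>k\<in>K. Y k \<omega>)} \<le> exp (real (card K) * c - t)"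
proof -
  have rv[measurable]: "Y k \<in> borel_measurable M" if "k \<in> K" for k
    using ind that by (auto simp: indep_vars_def)
  have "indep_vars (\<lambda>_. borel) (\<lambda>k \<omega>. ennreal (exp (Y k \<omega>))) K"
    by (rule indep_vars_compose2[OF ind]) measurable
  then have "(\<integral>\<^sup>+\<omega>. (\<Prod>k\<in>K. ennreal (exp (Y k \<omega>))) \<partial>M) =
      (\<Prod>k\<in>K. \<integral>\<^sup>+\<omega>. ennreal (exp (Y k \<omega>)) \<partial>M)"
    using assms(1) by (intro indep_vars_nn_integral) auto
  also have "\<dots> \<le> (\<Prod>k\<in>K. ennreal (exp c))"
    using mgf by (intro prod_mono_ennreal) auto
  also have "\<dots> = ennreal (exp (real (card K) * c))"
    by (simp add: ennreal_power exp_of_nat_mult)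
  finally have mgf_sum: "(\<integral>\<^sup>+\<omega>. ennreal (exp (\<Sum>k\<in>K. Y k \<omega>)) \<partial>M) \<le> ennreal (exp (real (card K) * c))"
    using assms(1) by (simp add: exp_sum prod_ennreal)
  have "emeasure M {\<omega> \<in> space M. t \<le> (\<Sum>k\<in>K. Y k \<omega>)} =
      emeasure M ({\<omega> \<in> space M. 1 \<le> ennreal (exp (- t)) * ennreal (exp (\<Sum>k\<in>K. Y k \<omega>))})"
    by (intro arg_cong[where f = "emeasure M"])
       (auto simp flip: ennreal_mult' exp_add)
  also have "\<dots> \<le> ennreal (exp (- t)) * (\<integral>\<^sup>+\<omega>. ennreal (exp (\<Sum>k\<in>K. Y k \<omega>)) \<partial>M)"
    using nn_integral_Markov_inequality[of "\<lambda>\<omega>. ennreal (exp (\<Sum>k\<in>K. Y k \<omega>))" "space M" M "ennreal (exp (- t))"]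
    by (simp add: nn_integral_cmult)
  also have "\<dots> \<le> ennreal (exp (- t)) * ennreal (exp (real (card K) * c))"
    by (intro mult_left_mono mgf_sum) simp
  also have "\<dots> = ennreal (exp (real (card K) * c - t))"
    by (simp flip: ennreal_mult' exp_add)
  finally show ?thesis by (simp add: emeasure_eq_measure)
qed

text \<open>Integrating out \<open>Y\<close> for a fixed value \<open>x\<close> of \<open>X\<close>
  leaves \<open>exp (a\<^sup>2 / 2 * x\<^sup>2)\<close>, whose Gaussian expectation is
  \<open>1 / sqrt (1 - a\<^sup>2)\<close>.\<close>

lemma nn_integral_exp_mult_std_normal:
  assumes dX: "distributed M lborel X std_normal_density"
    and dY: "distributed M lborel Y std_normal_density"
    and ind: "indep_var borel X borel Y" and "a\<^sup>2 \<le> 1 / 2"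
  shows "(\<integral>\<^sup>+\<omega>. ennreal (exp (a * (X \<omega> * Y \<omega>))) \<partial>M) \<le> ennreal (exp (a\<^sup>2))"
proof -
  have rv[measurable]: "random_variable borel X" "random_variable borel Y"
    using indep_var_rv1[OF ind] indep_var_rv2[OF ind] by auto
  have eq: "distr M borel X \<Otimes>\<^sub>M distr M borel Y = distr M (borel \<Otimes>\<^sub>M borel) (\<lambda>\<omega>. (X \<omega>, Y \<omega>))"
    using ind by (simp add: indep_var_distribution_eq)
  interpret Y: prob_space "distr M borel Y" by (rule prob_space_distr) simp
  have mgf: "(\<integral>\<^sup>+\<omega>. ennreal (exp (b * Y \<omega>)) \<partial>M) = ennreal (exp (b\<^sup>2 / 2))" for b
    using distributed_nn_integral[OF dY, of "\<lambda>y. ennreal (exp (b * y))"]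
    by (simp add: nn_integral_std_normal_exp)
  have "(\<integral>\<^sup>+\<omega>. ennreal (exp (a * (X \<omega> * Y \<omega>))) \<partial>M) =
      (\<integral>\<^sup>+z. ennreal (exp (a * (fst z * snd z))) \<partial>(distr M borel X \<Otimes>\<^sub>M distr M borel Y))"
    unfolding eq by (subst nn_integral_distr) auto
  also have "\<dots> = (\<integral>\<^sup>+x. \<integral>\<^sup>+y. ennreal (exp (a * (x * y))) \<partial>distr M borel Y \<partial>distr M borel X)"
  proof -
    have "(\<lambda>z. ennreal (exp (a * (fst z * snd z)))) \<in> borel_measurable (borel \<Otimes>\<^sub>M borel)"
      by measurable
    then have "(\<lambda>z. ennreal (exp (a * (fst z * snd z)))) \<in>
        borel_measurable (distr M borel X \<Otimes>\<^sub>M distr M borel Y)"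
      unfolding eq by simp
    from Y.nn_integral_fst[OF this] show ?thesis by simp
  qed
  also have "\<dots> = (\<integral>\<^sup>+x. ennreal (exp ((a\<^sup>2 / 2) * x\<^sup>2)) \<partial>distr M borel X)"
  proof (rule nn_integral_cong)
    fix x
    have "(\<integral>\<^sup>+y. ennreal (exp (a * (x * y))) \<partial>distr M borel Y) = (\<integral>\<^sup>+\<omega>. ennreal (exp (a * x * Y \<omega>)) \<partial>M)"
      by (simp add: nn_integral_distr mult.assoc)
    then show "(\<integral>\<^sup>+y. ennreal (exp (a * (x * y))) \<partial>distr M borel Y) = ennreal (exp ((a\<^sup>2 / 2) * x\<^sup>2))"
      by (simp add: mgf power_mult_distrib)
  qed
  also have "\<dots> = (\<integral>\<^sup>+\<omega>. ennreal (exp ((a\<^sup>2 / 2) * (X \<omega>)\<^sup>2)) \<partial>M)"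
    by (simp add: nn_integral_distr)
  also have "\<dots> = ennreal (1 / sqrt (1 - a\<^sup>2))"
    using assms(4) nn_integral_std_normal_exp_square[of "a\<^sup>2 / 2"]
    by (subst distributed_nn_integral[OF dX, symmetric]) auto
  also have "\<dots> \<le> ennreal (exp (a\<^sup>2))"
    using assms(4) by (intro ennreal_leI inverse_sqrt_le_exp) auto
  finally show ?thesis .
qed

end

section \<open>Greedy matching\<close>

text \<open>As long as all earlier picks are diagonal, the used rows and used columns have the same
  indices. Hence a free row \<open>i\<close> still offers \<open>(i, i)\<close>, which strictly
  beats every other entry of that row.\<close>

lemma greedy_selection_diagonal:
  assumes "greedy_selection C ps"
    and dom: "\<And>i j. i < dim_row C \<Longrightarrow> j < dim_row C \<Longrightarrow> i \<noteq> j \<Longrightarrow> C $$ (i, j) < C $$ (i, i)"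
  shows "distinct ps \<and> set ps \<subseteq> (\<lambda>i. (i, i)) ` {..<dim_row C}"
  using assms(1)
proof induction
  case (greedy_snoc ps q)
  obtain i j where q: "q = (i, j)" by (cases q)
  have ij: "i < dim_row C" "j < dim_row C" "i \<notin> fst ` set ps" "q \<notin> set ps"
    using greedy_snoc.hyps(2) by (force simp: q remaining_def)+
  have "i \<notin> snd ` set ps" using greedy_snoc.IH ij(3) by force
  then have "(i, i) \<in> remaining (dim_row C) ps" using ij by (simp add: remaining_def)
  then have "C $$ (i, i) \<le> C $$ (i, j)" using greedy_snoc.hyps(3) q by blast
  then have "i = j" using dom[of i j] ij by fastforce
  then show ?case using greedy_snoc.IH ij by (auto simp: q)
qed simp

text \<open>A complete selection consists of \<open>dim_row C\<close> distinct diagonal positions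
  and so exhausts the diagonal, however ties are broken.\<close>

lemma gmwm_row_dominant:
  assumes "\<And>i j. i < dim_row C \<Longrightarrow> j < dim_row C \<Longrightarrow> i \<noteq> j \<Longrightarrow> C $$ (i, j) < C $$ (i, i)"
  shows "gmwm C \<subseteq> {1\<^sub>m (dim_row C)}"
proof
  fix X assume "X \<in> gmwm C"
  then obtain ps where X: "X = mat (dim_row C) (dim_row C) (\<lambda>q. if q \<in> set ps then 1 else 0)"
    and ps: "greedy_selection C ps" "length ps = dim_row C"
    unfolding gmwm_def by blast
  let ?D = "(\<lambda>i. (i, i)) ` {..<dim_row C}"
  have d: "distinct ps" "set ps \<subseteq> ?D"
    using greedy_selection_diagonal[OF ps(1)] assms by auto
  have "card ?D = dim_row C" by (subst card_image) (auto simp: inj_on_def)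
  then have "set ps = ?D"
    using d ps(2) distinct_card[of ps] by (intro card_subset_eq) auto
  then show "X \<in> {1\<^sub>m (dim_row C)}" unfolding X by (auto intro!: eq_matI)
qed

section \<open>From a single step to all iterations\<close>

lemma one_mat_in_permutation_mats: "1\<^sub>m n \<in> permutation_mats n"
  unfolding permutation_mats_def
  by (rule CollectI, rule exI[of _ id]) (auto simp: permutes_id intro!: eq_matI)

lemma fixed_points_one_mat: "fixed_points (1\<^sub>m n :: real mat) = {..<n}"
  by (auto simp: fixed_points_def)

text \<open>The identity fixes all \<open>n\<close> points, so it meets the condition on the initial
  matrix itself and a step from it returns to it. The count \<open>Suc k\<close> reflects that zero
  iterations would return \<open>X0\<close> unchanged.\<close>

lemma ppmgm_eq_one:
  assumes step: "\<And>X. X \<in> permutation_mats n \<Longrightarrow> (1 - \<kappa>) * real n \<le> real (card (fixed_points X)) \<Longrightarrow>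
      gmwm (A * X * B) \<subseteq> {1\<^sub>m n}"
    and "0 \<le> \<kappa>"
    and X0: "X0 \<in> permutation_mats n" "(1 - \<kappa>) * real n \<le> real (card (fixed_points X0))"
  shows "ppmgm A B X0 (Suc k) \<subseteq> {1\<^sub>m n}"
proof (induction k)
  case 0
  then show ?case using step X0 by simp
next
  case (Suc k)
  have "(1 - \<kappa>) * real n \<le> real (card (fixed_points (1\<^sub>m n :: real mat)))"
    using assms(2) by (simp add: fixed_points_one_mat algebra_simps)
  then have "gmwm (A * 1\<^sub>m n * B) \<subseteq> {1\<^sub>m n}"
    using step one_mat_in_permutation_mats by blast
  then show ?case using Suc by (subst ppmgm.simps(2)) blast
qed

section \<open>Entries of \<open>A X B\<close> and the cost of displaced indices\<close>

lemma sandwich_index: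
  fixes A B X :: "real mat"
  assumes "A \<in> carrier_mat n n" "B \<in> carrier_mat n n" "X \<in> carrier_mat n n" "i < n" "j < n"
  shows "(A * X * B) $$ (i, j) = (\<Sum>l<n. (\<Sum>k<n. A $$ (i, k) * X $$ (k, l)) * B $$ (l, j))"
  using assms by (simp add: scalar_prod_def lessThan_atLeast0 del: assoc_mult_mat)

lemma sandwich_permutation_index:
  fixes A B :: "real mat"
  assumes "A \<in> carrier_mat n n" "B \<in> carrier_mat n n" "p permutes {..<n}" "i < n" "j < n"
  shows "(A * mat n n (\<lambda>(k, l). if l = p k then 1 else 0) * B) $$ (i, j) =
    (\<Sum>k<n. A $$ (i, k) * B $$ (p k, j))"
proof -
  have p: "p k < n" if "k < n" for k using permutes_in_image[OF assms(3)] that by auto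
  have "(A * mat n n (\<lambda>(k, l). if l = p k then 1 else 0) * B) $$ (i, j) =
      (\<Sum>l<n. (\<Sum>k<n. A $$ (i, k) * (if l = p k then 1 else 0)) * B $$ (l, j))"
    using assms by (subst sandwich_index[of _ n]) (auto intro!: sum.cong)
  also have "\<dots> = (\<Sum>l<n. \<Sum>k<n. if l = p k then A $$ (i, k) * B $$ (l, j) else 0)"
    by (auto simp: sum_distrib_right intro!: sum.cong)
  also have "\<dots> = (\<Sum>k<n. \<Sum>l<n. if l = p k then A $$ (i, k) * B $$ (l, j) else 0)"
    by (rule sum.swap)
  also have "\<dots> = (\<Sum>k<n. A $$ (i, k) * B $$ (p k, j))"
    using p by (intro sum.cong) (auto simp: sum.delta')
  finally show ?thesis .
qed

text \<open>Fixed indices cancel. On the displaced set \<open>T\<close> AM-GM applies, and since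
  \<open>p\<close> permutes \<open>T\<close> the squares of the permuted values have the same sum as
  those of the original ones.\<close>

lemma permuted_product_sum_error:
  fixes a b :: "'k \<Rightarrow> real"
  assumes "finite K" "p permutes K"
  defines "T \<equiv> {k \<in> K. p k \<noteq> k}"
  shows "\<bar>(\<Sum>k\<in>K. a k * b (p k)) - (\<Sum>k\<in>K. a k * b k)\<bar> \<le> (\<Sum>k\<in>T. (a k)\<^sup>2) + (\<Sum>k\<in>T. (b k)\<^sup>2)"
proof -
  have T: "finite T" "T \<subseteq> K" using assms(1) by (auto simp: T_def)
  have inj: "inj p" using assms(2) by (rule permutes_inj)
  have "p ` T = T"
  proof (rule endo_inj_surj)
    show "p ` T \<subseteq> T"
      using permutes_in_image[OF assms(2)] inj by (auto simp: T_def inj_eq)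
  qed (use T inj_on_subset[OF inj] in auto)
  then have bij: "bij_betw p T T" using inj_on_subset[OF inj] by (simp add: bij_betw_def)
  have "(\<Sum>k\<in>K. a k * b (p k)) - (\<Sum>k\<in>K. a k * b k) = (\<Sum>k\<in>K. a k * (b (p k) - b k))"
    by (simp add: sum_subtractf right_diff_distrib)
  also have "\<dots> = (\<Sum>k\<in>T. a k * (b (p k) - b k))"
    using assms(1) T by (intro sum.mono_neutral_right) (auto simp: T_def)
  also have "\<bar>\<dots>\<bar> \<le> (\<Sum>k\<in>T. (a k)\<^sup>2 + ((b (p k))\<^sup>2 + (b k)\<^sup>2) / 2)"
  proof (rule order.trans[OF sum_abs], rule sum_mono)
    fix k
    \<comment> \<open>With \<open>d = b (p k) - b k\<close>, the first two squares give
      \<open>\<bar>a k * d\<bar> \<le> (a k)\<^sup>2 + d\<^sup>2 / 4\<close>; the third gives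
      \<open>d\<^sup>2 \<le> 2 * ((b (p k))\<^sup>2 + (b k)\<^sup>2)\<close>.\<close>
    have "0 \<le> (2 * a k + (b (p k) - b k))\<^sup>2" "0 \<le> (2 * a k - (b (p k) - b k))\<^sup>2"
      "0 \<le> (b (p k) + b k)\<^sup>2" by auto
    then show "\<bar>a k * (b (p k) - b k)\<bar> \<le> (a k)\<^sup>2 + ((b (p k))\<^sup>2 + (b k)\<^sup>2) / 2"
      unfolding abs_le_iff by (simp add: power2_eq_square algebra_simps add_divide_distrib)
  qed
  also have "\<dots> = (\<Sum>k\<in>T. (a k)\<^sup>2) + ((\<Sum>k\<in>T. (b (p k))\<^sup>2) + (\<Sum>k\<in>T. (b k)\<^sup>2)) / 2"
    by (simp add: sum.distrib flip: sum_divide_distrib)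
  also have "(\<Sum>k\<in>T. (b (p k))\<^sup>2) = (\<Sum>k\<in>T. (b k)\<^sup>2)"
    by (rule sum.reindex_bij_betw[OF bij])
  finally show ?thesis by simp
qed

text \<open>Controls all subsets of a given size at once, so that no union bound over subsets is needed.\<close>

lemma sum_squares_subset_le_excess:
  fixes x :: "'k \<Rightarrow> real"
  assumes "finite K" "T \<subseteq> K"
  shows "(\<Sum>k\<in>T. (x k)\<^sup>2) \<le> real (card T) * \<theta> + (\<Sum>k\<in>K. max 0 ((x k)\<^sup>2 - \<theta>))"
proof -
  have "(\<Sum>k\<in>T. (x k)\<^sup>2) \<le> (\<Sum>k\<in>T. \<theta> + max 0 ((x k)\<^sup>2 - \<theta>))"
    by (intro sum_mono) auto
  also have "\<dots> = real (card T) * \<theta> + (\<Sum>k\<in>T. max 0 ((x k)\<^sup>2 - \<theta>))"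
    by (simp add: sum.distrib)
  also have "(\<Sum>k\<in>T. max 0 ((x k)\<^sup>2 - \<theta>)) \<le> (\<Sum>k\<in>K. max 0 ((x k)\<^sup>2 - \<theta>))"
    using assms by (intro sum_mono2) auto
  finally show ?thesis by simp
qed

section \<open>Measurability\<close>

lemma greedy_selection_snoc_iff:
  "greedy_selection C (ps @ [q]) \<longleftrightarrow> greedy_selection C ps \<and> q \<in> remaining (dim_row C) ps \<and>
     (\<forall>r \<in> remaining (dim_row C) ps. C $$ r \<le> C $$ q)"
  by (auto elim: greedy_selection.cases intro: greedy_snoc)

text \<open>For a fixed list the condition is a finite conjunction of comparisons between entries of
  \<open>C \<omega>\<close>.\<close>

lemma pred_greedy_selection:
  assumes dim: "\<And>\<omega>. \<omega> \<in> space M \<Longrightarrow> dim_row (C \<omega>) = n"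
    and C: "\<And>i j. i < n \<Longrightarrow> j < n \<Longrightarrow> (\<lambda>\<omega>. C \<omega> $$ (i, j)) \<in> borel_measurable M"
  shows "Measurable.pred M (\<lambda>\<omega>. greedy_selection (C \<omega>) ps)"
proof (induction ps rule: rev_induct)
  case Nil
  then show ?case by (simp add: greedy_Nil)
next
  case (snoc q ps)
  have "Measurable.pred M (\<lambda>\<omega>. greedy_selection (C \<omega>) ps \<and> q \<in> remaining n ps \<and>
      (\<forall>r \<in> remaining n ps. C \<omega> $$ r \<le> C \<omega> $$ q))"
  proof (cases "q \<in> remaining n ps")
    case True
    have [measurable]: "(\<lambda>\<omega>. C \<omega> $$ r) \<in> borel_measurable M" if "r \<in> remaining n ps" for r
      using that C by (auto simp: remaining_def)
    have "Measurable.pred M (\<lambda>\<omega>. \<forall>r \<in> remaining n ps. C \<omega> $$ r \<le> C \<omega> $$ q)"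
      using True by (intro pred_intros_finite finite_remaining) measurable
    then show ?thesis using snoc True by simp
  qed simp
  then show ?case
    by (rule measurable_cong[THEN iffD1, rotated]) (simp add: greedy_selection_snoc_iff dim)
qed

lemma pred_mem_gmwm:
  assumes dim: "\<And>\<omega>. \<omega> \<in> space M \<Longrightarrow> dim_row (C \<omega>) = n"
    and C: "\<And>i j. i < n \<Longrightarrow> j < n \<Longrightarrow> (\<lambda>\<omega>. C \<omega> $$ (i, j)) \<in> borel_measurable M"
  shows "Measurable.pred M (\<lambda>\<omega>. X \<in> gmwm (C \<omega>))"
proof -
  \<comment> \<open>The finitely many candidate selections that would produce \<open>X\<close>;
    membership in \<open>gmwm\<close> is a finite disjunction over them.\<close>
  define P where "P = {ps. set ps \<subseteq> {..<n} \<times> {..<n} \<and> length ps = n \<and>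
      X = mat n n (\<lambda>q. if q \<in> set ps then 1 else 0)}"
  have "finite P"
    by (rule finite_subset[OF _ finite_lists_length_eq[of "{..<n} \<times> {..<n}" n]]) (auto simp: P_def)
  then have "Measurable.pred M (\<lambda>\<omega>. \<exists>ps\<in>P. greedy_selection (C \<omega>) ps)"
    by (intro pred_intros_finite pred_greedy_selection[of M C n] dim C) auto
  moreover have "(\<exists>ps\<in>P. greedy_selection (C \<omega>) ps) \<longleftrightarrow> X \<in> gmwm (C \<omega>)" if "\<omega> \<in> space M" for \<omega>
  proof -
    have "set ps \<subseteq> {..<n} \<times> {..<n}" if "greedy_selection (C \<omega>) ps" for ps
      using that dim[OF \<open>\<omega> \<in> space M\<close>] by induction (auto simp: remaining_def)
    then show ?thesis using dim[OF that] by (auto simp: gmwm_def P_def)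
  qed
  ultimately show ?thesis by (rule measurable_cong[THEN iffD1, rotated])
qed

text \<open>Provides a finite range that depends only on the dimension, so that quantifiers over
  random sets of iterates become finite and deterministic.\<close>

lemma gmwm_subset:
  "gmwm C \<subseteq> (\<lambda>S. mat (dim_row C) (dim_row C) (\<lambda>q. if q \<in> S then 1 else 0)) `
     Pow ({..<dim_row C} \<times> {..<dim_row C})"
proof
  fix X assume "X \<in> gmwm C"
  then obtain ps where X: "X = mat (dim_row C) (dim_row C) (\<lambda>q. if q \<in> set ps then 1 else 0)"
    unfolding gmwm_def by blast
  show "X \<in> (\<lambda>S. mat (dim_row C) (dim_row C) (\<lambda>q. if q \<in> S then 1 else 0)) `
     Pow ({..<dim_row C} \<times> {..<dim_row C})"
    \<comment> \<open>Intersecting with the square leaves the matrix unchanged and spares a proof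
      that selections stay inside it.\<close>
    by (rule image_eqI[of _ _ "set ps \<inter> {..<dim_row C} \<times> {..<dim_row C}"])
       (auto simp: X intro!: eq_matI)
qed

text \<open>Induction over the iterations: the previous iterate ranges over a finite set
  \<open>F\<close>, and for each fixed value the next step is a measurable \<open>gmwm\<close>
  event. \<open>F\<close> contains \<open>X0\<close> to cover zero iterations.\<close>

lemma pred_mem_ppmgm:
  assumes A: "\<And>\<omega>. \<omega> \<in> space M \<Longrightarrow> A \<omega> \<in> carrier_mat n n"
      "\<And>i j. i < n \<Longrightarrow> j < n \<Longrightarrow> (\<lambda>\<omega>. A \<omega> $$ (i, j)) \<in> borel_measurable M"
    and B: "\<And>\<omega>. \<omega> \<in> space M \<Longrightarrow> B \<omega> \<in> carrier_mat n n"
      "\<And>i j. i < n \<Longrightarrow> j < n \<Longrightarrow> (\<lambda>\<omega>. B \<omega> $$ (i, j)) \<in> borel_measurable M"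
    and X0: "X0 \<in> carrier_mat n n"
  shows "Measurable.pred M (\<lambda>\<omega>. X \<in> ppmgm (A \<omega>) (B \<omega>) X0 k)"
proof (induction k arbitrary: X)
  case 0
  then show ?case by simp
next
  case (Suc k)
  define F where "F = insert X0 ((\<lambda>S. mat n n (\<lambda>q. if q \<in> S then 1 else 0)) ` Pow ({..<n} \<times> {..<n}))"
  have F: "finite F" "F \<subseteq> carrier_mat n n" using X0 by (auto simp: F_def)
  have sub: "ppmgm (A \<omega>) (B \<omega>) X0 k \<subseteq> F" if "\<omega> \<in> space M" for \<omega>
  proof (cases k)
    case (Suc m)
    have "gmwm (A \<omega> * Y * B \<omega>) \<subseteq> F" for Y
      using gmwm_subset[of "A \<omega> * Y * B \<omega>"] A(1)[OF that] by (auto simp: F_def)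
    then show ?thesis by (auto simp: Suc)
  qed (simp add: F_def)
  have gm: "Measurable.pred M (\<lambda>\<omega>. X \<in> gmwm (A \<omega> * Y * B \<omega>))" if "Y \<in> F" for Y
  proof (rule pred_mem_gmwm[of _ _ n])
    show "dim_row (A \<omega> * Y * B \<omega>) = n" if "\<omega> \<in> space M" for \<omega> using A(1)[OF that] by simp
    fix i j assume ij: "i < n" "j < n"
    have "(\<lambda>\<omega>. \<Sum>l<n. (\<Sum>k<n. A \<omega> $$ (i, k) * Y $$ (k, l)) * B \<omega> $$ (l, j)) \<in> borel_measurable M"
      using ij by (intro borel_measurable_sum borel_measurable_times A(2) B(2)) auto
    then show "(\<lambda>\<omega>. (A \<omega> * Y * B \<omega>) $$ (i, j)) \<in> borel_measurable M"
      by (rule measurable_cong[THEN iffD1, rotated])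
         (use F(2) \<open>Y \<in> F\<close> ij in \<open>auto simp: sandwich_index[OF A(1) B(1)]\<close>)
  qed
  have "Measurable.pred M (\<lambda>\<omega>. \<exists>Y\<in>F. Y \<in> ppmgm (A \<omega>) (B \<omega>) X0 k \<and> X \<in> gmwm (A \<omega> * Y * B \<omega>))"
    by (intro pred_intros_finite F(1) pred_intros_logic Suc gm)
  then show ?case
    by (rule measurable_cong[THEN iffD1, rotated]) (use sub in auto)
qed

lemma finite_permutation_mats: "finite (permutation_mats n)"
proof -
  have "permutation_mats n = (\<lambda>p. mat n n (\<lambda>(i, j). if j = p i then 1 else 0)) ` {p. p permutes {..<n}}"
    by (auto simp: permutation_mats_def)
  then show ?thesis by (simp add: finite_permutations)
qed

text \<open>Needed because \<open>measure\<close> is 0 on non-measurable sets, so a lower bound by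
  monotonicity requires the success event to be measurable. Success means that no value other than
  \<open>Y\<close> in a finite range is an output.\<close>

lemma sets_ppmgm_all_eq:
  assumes A: "\<And>\<omega>. \<omega> \<in> space M \<Longrightarrow> A \<omega> \<in> carrier_mat n n"
      "\<And>i j. i < n \<Longrightarrow> j < n \<Longrightarrow> (\<lambda>\<omega>. A \<omega> $$ (i, j)) \<in> borel_measurable M"
    and B: "\<And>\<omega>. \<omega> \<in> space M \<Longrightarrow> B \<omega> \<in> carrier_mat n n"
      "\<And>i j. i < n \<Longrightarrow> j < n \<Longrightarrow> (\<lambda>\<omega>. B \<omega> $$ (i, j)) \<in> borel_measurable M"
  shows "{\<omega> \<in> space M. \<forall>X0 \<in> permutation_mats n. Q X0 \<longrightarrow> (\<forall>X \<in> ppmgm (A \<omega>) (B \<omega>) X0 k. X = Y)}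
    \<in> sets M"
proof -
  have "Measurable.pred M (\<lambda>\<omega>. \<forall>X \<in> ppmgm (A \<omega>) (B \<omega>) X0 k. X = Y)" if "X0 \<in> permutation_mats n" for X0
  proof -
    have X0: "X0 \<in> carrier_mat n n" using that by (auto simp: permutation_mats_def)
    define F where "F = insert X0 ((\<lambda>S. mat n n (\<lambda>q. if q \<in> S then 1 else 0)) ` Pow ({..<n} \<times> {..<n})) - {Y}"
    have sub: "ppmgm (A \<omega>) (B \<omega>) X0 k \<subseteq> insert Y F" if "\<omega> \<in> space M" for \<omega>
    proof (cases k)
      case (Suc m)
      have "gmwm (A \<omega> * Z * B \<omega>) \<subseteq> insert Y F" for Z
        using gmwm_subset[of "A \<omega> * Z * B \<omega>"] A(1)[OF that] by (auto simp: F_def)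
      then show ?thesis by (auto simp: Suc)
    qed (auto simp: F_def)
    have "Measurable.pred M (\<lambda>\<omega>. \<forall>X\<in>F. X \<notin> ppmgm (A \<omega>) (B \<omega>) X0 k)"
      by (intro pred_intros_finite pred_intros_logic pred_mem_ppmgm[of M A n B] A B X0) (auto simp: F_def)
    moreover have "Y \<notin> F" by (simp add: F_def)
    then have "(\<forall>X\<in>F. X \<notin> ppmgm (A \<omega>) (B \<omega>) X0 k) \<longleftrightarrow> (\<forall>X \<in> ppmgm (A \<omega>) (B \<omega>) X0 k. X = Y)"
      if "\<omega> \<in> space M" for \<omega>
      using sub[OF that] by (auto dest: subsetD)
    ultimately show ?thesis by (rule measurable_cong[THEN iffD1, rotated])
  qed
  then have "Measurable.pred M (\<lambda>\<omega>. \<forall>X0 \<in> permutation_mats n. Q X0 \<longrightarrow> (\<forall>X \<in> ppmgm (A \<omega>) (B \<omega>) X0 k. X = Y))"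
    by (intro pred_intros_finite finite_permutation_mats pred_intros_imp') auto
  then show ?thesis by (simp add: pred_def)
qed

section \<open>Row dominance\<close>

text \<open>The deterministic core, with \<open>x\<close> and \<open>z\<close> scaled so that
  entries have unit order. In units of \<open>\<rho> * real n\<close>, the diagonal sum exceeds 3/4
  - 1/32 - 1/4 and the other one is below 1/16 + 1/32 + 1/4, which leaves a gap of 1/8.\<close>

lemma row_dominance:
  fixes x z :: "nat \<Rightarrow> nat \<Rightarrow> real" and n :: nat and \<theta> :: real
  defines "excess \<equiv> \<lambda>w i. \<Sum>k<n. max 0 ((w i k)\<^sup>2 - \<theta>)"
  assumes sym: "\<And>i k. x i k = x k i" "\<And>i k. z i k = z k i"
    and \<rho>: "0 < \<rho>" "0 \<le> \<sigma>" "\<rho>\<^sup>2 + \<sigma>\<^sup>2 = 1"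
    and \<theta>: "0 \<le> \<theta>" "\<kappa> * \<theta> \<le> \<rho> / 24"
    and sq: "3 / 4 * real n < (\<Sum>k<n. (x i k)\<^sup>2)"
    and xx: "(\<Sum>k<n. x i k * x j k) < 1 / 16 * real n"
    and xz: "\<And>l. l < n \<Longrightarrow> \<bar>\<Sum>k<n. x i k * z l k\<bar> < \<rho> / 32 * real n"
    and exc: "\<And>l. l < n \<Longrightarrow> excess x l < \<rho> / 24 * real n" "\<And>l. l < n \<Longrightarrow> excess z l < \<rho> / 24 * real n"
    and ij: "i < n" "j < n"
    and p: "p permutes {..<n}" "real (card {k \<in> {..<n}. p k \<noteq> k}) \<le> \<kappa> * real n"
  shows "(\<Sum>k<n. x i k * (\<rho> * x (p k) j + \<sigma> * z (p k) j)) <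
    (\<Sum>k<n. x i k * (\<rho> * x (p k) i + \<sigma> * z (p k) i))"
proof -
  \<comment> \<open>The arguments are swapped on purpose: \<open>y l\<close> is column
    \<open>l\<close> of the correlated matrix.\<close>
  define y where "y l k = \<rho> * x k l + \<sigma> * z k l" for k l
  let ?T = "{k \<in> {..<n}. p k \<noteq> k}"
  have "real (card ?T) * \<theta> \<le> \<kappa> * real n * \<theta>"
    using p(2) \<theta>(1) by (rule mult_right_mono)
  also have "\<dots> \<le> \<rho> / 24 * real n"
    using mult_right_mono[OF \<theta>(2), of "real n"] by (simp add: mult_ac)
  finally have "real (card ?T) * \<theta> \<le> \<rho> / 24 * real n" .
  \<comment> \<open>One half of \<rho>/12 pays for the displaced indices at the threshold \<theta>,
    the other half for the excess above it.\<close>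
  then have top: "(\<Sum>k\<in>?T. (w l k)\<^sup>2) \<le> \<rho> / 12 * real n" if "excess w l < \<rho> / 24 * real n" for w l
  proof -
    have "(\<Sum>k\<in>?T. (w l k)\<^sup>2) \<le> real (card ?T) * \<theta> + excess w l"
      unfolding excess_def by (rule sum_squares_subset_le_excess) auto
    then show ?thesis using that \<open>real (card ?T) * \<theta> \<le> \<rho> / 24 * real n\<close> by argo
  qed
  \<comment> \<open>Three contributions of \<rho>/12 each: row \<open>i\<close> of \<open>x\<close>,
    and rows \<open>l\<close> of \<open>x\<close> and \<open>z\<close>, whose squares dominate those
    of \<open>y l\<close>.\<close>
  have err: "\<bar>(\<Sum>k<n. x i k * y l (p k)) - (\<Sum>k<n. x i k * y l k)\<bar> \<le> \<rho> / 4 * real n" if "l < n" for l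
  proof -
    have "(y l k)\<^sup>2 \<le> (x l k)\<^sup>2 + (z l k)\<^sup>2" for k
    proof -
      \<comment> \<open>Two-square identity, that is, Cauchy-Schwarz for the unit vector with
        coordinates \<rho> and \<sigma>.\<close>
      have "(y l k)\<^sup>2 + (\<rho> * z k l - \<sigma> * x k l)\<^sup>2 = (\<rho>\<^sup>2 + \<sigma>\<^sup>2) * ((x k l)\<^sup>2 + (z k l)\<^sup>2)"
        by (simp add: y_def power2_eq_square algebra_simps)
      moreover have "(y l k)\<^sup>2 \<le> (y l k)\<^sup>2 + (\<rho> * z k l - \<sigma> * x k l)\<^sup>2" by simp
      ultimately have "(y l k)\<^sup>2 \<le> (x k l)\<^sup>2 + (z k l)\<^sup>2" unfolding \<rho>(3) by argo
      then show ?thesis by (simp only: sym[of l k])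
    qed
    then have "(\<Sum>k\<in>?T. (y l k)\<^sup>2) \<le> (\<Sum>k\<in>?T. (x l k)\<^sup>2) + (\<Sum>k\<in>?T. (z l k)\<^sup>2)"
      by (simp add: sum_mono flip: sum.distrib)
    then show ?thesis
      using permuted_product_sum_error[OF finite_lessThan p(1), of "x i" "y l"]
        top[OF exc(1)[OF ij(1)]] top[OF exc(1)[OF that]] top[OF exc(2)[OF that]] by linarith
  qed
  have main: "(\<Sum>k<n. x i k * y l k) = \<rho> * (\<Sum>k<n. x i k * x l k) + \<sigma> * (\<Sum>k<n. x i k * z l k)" for l
    using sym by (simp add: y_def sum_distrib_left algebra_simps flip: sum.distrib)
  have "\<sigma>\<^sup>2 \<le> 1" using \<rho>(3) by (smt (verit) zero_le_power2)
  then have "\<sigma> \<le> 1" using \<rho>(2) by (simp add: power_le_one_iff)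
  then have noise: "\<bar>\<sigma> * (\<Sum>k<n. x i k * z l k)\<bar> < \<rho> / 32 * real n" if "l < n" for l
    using xz[OF that] \<rho>(2) mult_left_le_one_le[of "\<bar>\<Sum>k<n. x i k * z l k\<bar>" \<sigma>] by (simp add: abs_mult)
  have "\<rho> * (\<Sum>k<n. x i k * x j k) < \<rho> * (1 / 16 * real n)"
    "\<rho> * (3 / 4 * real n) < \<rho> * (\<Sum>k<n. x i k * x i k)"
    using xx sq \<rho>(1) by (simp_all add: power2_eq_square)
  moreover have "0 < \<rho> * real n" using \<rho>(1) ij(1) by simp
  ultimately have "(\<Sum>k<n. x i k * y j (p k)) < (\<Sum>k<n. x i k * y i (p k))"
    using err[OF ij(1)] err[OF ij(2)] main[of i] main[of j] noise[OF ij(1)] noise[OF ij(2)]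
    unfolding abs_le_iff abs_less_iff by argo
  then show ?thesis by (simp add: y_def)
qed

section \<open>Gaussian tail bounds\<close>

context prob_space
begin

lemma prob_UN_le_card:
  assumes "finite I" "\<And>i. i \<in> I \<Longrightarrow> E i \<in> events" "\<And>i. i \<in> I \<Longrightarrow> prob (E i) \<le> e"
  shows "prob (\<Union>i\<in>I. E i) \<le> real (card I) * e"
proof -
  have "prob (\<Union>i\<in>I. E i) \<le> (\<Sum>i\<in>I. prob (E i))"
    using assms by (intro finite_measure_subadditive_finite) auto
  also have "\<dots> \<le> real (card I) * e" using assms by (intro sum_bounded_above) auto
  finally show ?thesis .
qed

context
  fixes G :: "'i \<Rightarrow> 'a \<Rightarrow> real" and L :: "'i set"
  assumes ind: "indep_vars (\<lambda>_. borel) G L"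
    and std: "\<And>l. l \<in> L \<Longrightarrow> distributed M lborel (G l) std_normal_density"
begin

text \<open>Chernoff with parameter 1/16, giving the rate 1/20 - 3/64 = 1/320. The slack of one in
  the size of \<open>K\<close> accounts for the missing diagonal entry of a row and costs a factor
  \<open>exp (1 / 20)\<close>, bounded by 2.\<close>

lemma gaussian_square_sum_lower_tail:
  assumes "finite K" "inj_on u K" "u ` K \<subseteq> L" "n \<le> card K + 1"
  shows "prob {\<omega> \<in> space M. (\<Sum>k\<in>K. (G (u k) \<omega>)\<^sup>2) \<le> 3 / 4 * real n} \<le> 2 * exp (- (real n / 320))"
proof -
  let ?Y = "\<lambda>k \<omega>. - (1 / 16) * (G (u k) \<omega>)\<^sup>2"
  have indY: "indep_vars (\<lambda>_. borel) ?Y K"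
    using indep_vars_compose2[OF indep_vars_reindex_inj[OF ind assms(2,3)], of "\<lambda>_ x. - (1 / 16) * x\<^sup>2"]
    by simp
  have mgf: "(\<integral>\<^sup>+\<omega>. ennreal (exp (?Y k \<omega>)) \<partial>M) \<le> ennreal (exp (- (1 / 20)))" if "k \<in> K" for k
  proof -
    have "(\<integral>\<^sup>+\<omega>. ennreal (exp (?Y k \<omega>)) \<partial>M) = ennreal (1 / sqrt (9 / 8))"
      using nn_integral_std_normal_exp_square[of "- (1 / 16)"]
        distributed_nn_integral[OF std, of "u k" "\<lambda>x. ennreal (exp (- (1 / 16) * x\<^sup>2))"] that assms(3)
      by auto
    also have "1 / sqrt (9 / 8) \<le> exp (- (1 / 20) :: real)"
    proof -
      have "exp (1 / 10 :: real) \<le> 9 / 8"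
        using exp_bound[of "1 / 10 :: real"] by (simp add: power2_eq_square)
      then have "sqrt (exp (1 / 10)) \<le> sqrt (9 / 8 :: real)" by (rule real_sqrt_le_mono)
      moreover have "sqrt (exp (1 / 10)) = exp (1 / 20 :: real)"
        by (rule real_sqrt_unique) (simp_all flip: exp_of_nat_mult)
      ultimately have "exp (1 / 20) \<le> sqrt (9 / 8 :: real)" by simp
      then have "inverse (sqrt (9 / 8)) \<le> inverse (exp (1 / 20 :: real))" by (intro le_imp_inverse_le) auto
      then show ?thesis by (simp only: exp_minus inverse_eq_divide)
    qed
    finally show ?thesis by (simp add: ennreal_leI)
  qed
  have "{\<omega> \<in> space M. (\<Sum>k\<in>K. (G (u k) \<omega>)\<^sup>2) \<le> 3 / 4 * real n} =
      {\<omega> \<in> space M. - (3 / 64 * real n) \<le> (\<Sum>k\<in>K. ?Y k \<omega>)}"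
    unfolding sum_distrib_left[symmetric] by auto
  then have "prob {\<omega> \<in> space M. (\<Sum>k\<in>K. (G (u k) \<omega>)\<^sup>2) \<le> 3 / 4 * real n} \<le>
      exp (real (card K) * (- (1 / 20)) - (- (3 / 64 * real n)))"
    using chernoff_bound[OF assms(1) indY mgf] by presburger
  also have "\<dots> \<le> exp (1 / 20 + - (real n / 320))"
    using assms(4) by simp
  also have "\<dots> = exp (1 / 20) * exp (- (real n / 320))" by (rule exp_add)
  also have "exp (1 / 20 :: real) \<le> 2"
    using exp_bound[of "1 / 20 :: real"] by (simp add: power2_eq_square)
  finally show ?thesis by simp
qed

text \<open>Chernoff for products of independent Gaussians. The parameter \<delta>/2 minimises
  \<open>a\<^sup>2 - a * \<delta>\<close>; the sign \<open>s\<close> treats both tails at once, and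
  \<delta> at most 1 keeps the parameter in the range of the moment bound.\<close>

lemma gaussian_inner_product_tail:
  assumes K: "finite K" "card K \<le> n"
    and u: "inj_on u K" "u ` K \<subseteq> L" and v: "inj_on v K" "v ` K \<subseteq> L"
    and uv: "u ` K \<inter> v ` K = {}" and "0 < \<delta>" "\<delta> \<le> 1"
  shows "prob {\<omega> \<in> space M. \<delta> * real n \<le> (\<Sum>k\<in>K. G (u k) \<omega> * G (v k) \<omega>)} \<le> exp (- (\<delta>\<^sup>2 / 4 * real n))"
    and "prob {\<omega> \<in> space M. \<delta> * real n \<le> \<bar>\<Sum>k\<in>K. G (u k) \<omega> * G (v k) \<omega>\<bar>} \<le>
      2 * exp (- (\<delta>\<^sup>2 / 4 * real n))"
proof -
  have rv[measurable]: "random_variable borel (G l)" if "l \<in> L" for l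
    using ind that by (auto simp: indep_vars_def)
  have signed: "prob {\<omega> \<in> space M. \<delta> * real n \<le> s * (\<Sum>k\<in>K. G (u k) \<omega> * G (v k) \<omega>)} \<le>
      exp (- (\<delta>\<^sup>2 / 4 * real n))" if s: "s\<^sup>2 = 1" for s :: real
  proof -
    let ?Y = "\<lambda>k \<omega>. (s * \<delta> / 2) * (G (u k) \<omega> * G (v k) \<omega>)"
    have indY: "indep_vars (\<lambda>_. borel) ?Y K"
      by (rule indep_vars_pairs[OF ind u v uv, where h = "\<lambda>x y. (s * \<delta> / 2) * (x * y)"]) measurable
    have a: "(s * \<delta> / 2)\<^sup>2 = \<delta>\<^sup>2 / 4" using s by (simp add: power_mult_distrib power_divide)
    have "\<delta>\<^sup>2 \<le> 1" using assms(8,9) by (simp add: power_le_one)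
    have mgf: "(\<integral>\<^sup>+\<omega>. ennreal (exp (?Y k \<omega>)) \<partial>M) \<le> ennreal (exp (\<delta>\<^sup>2 / 4))" if "k \<in> K" for k
    proof -
      have L: "u k \<in> L" "v k \<in> L" "u k \<noteq> v k" using that u v uv by auto
      show ?thesis
        using nn_integral_exp_mult_std_normal[OF std[OF L(1)] std[OF L(2)]
            indep_var_of_indep_vars[OF ind L], of "s * \<delta> / 2"] \<open>\<delta>\<^sup>2 \<le> 1\<close>
        unfolding a by simp
    qed
    have "{\<omega> \<in> space M. \<delta> * real n \<le> s * (\<Sum>k\<in>K. G (u k) \<omega> * G (v k) \<omega>)} =
        {\<omega> \<in> space M. \<delta>\<^sup>2 / 2 * real n \<le> (\<Sum>k\<in>K. ?Y k \<omega>)}"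
    proof -
      have "\<delta>\<^sup>2 / 2 * real n \<le> (\<Sum>k\<in>K. ?Y k \<omega>) \<longleftrightarrow>
          (\<delta> / 2) * (\<delta> * real n) \<le> (\<delta> / 2) * (s * (\<Sum>k\<in>K. G (u k) \<omega> * G (v k) \<omega>))" for \<omega>
        unfolding sum_distrib_left[symmetric] by (simp add: power2_eq_square mult_ac)
      then show ?thesis using \<open>0 < \<delta>\<close> by simp
    qed
    then have "prob {\<omega> \<in> space M. \<delta> * real n \<le> s * (\<Sum>k\<in>K. G (u k) \<omega> * G (v k) \<omega>)} \<le>
        exp (real (card K) * (\<delta>\<^sup>2 / 4) - \<delta>\<^sup>2 / 2 * real n)"
      using chernoff_bound[OF K(1) indY mgf] by presburger
    also have "\<dots> \<le> exp (- (\<delta>\<^sup>2 / 4 * real n))"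
    proof -
      have "real (card K) * (\<delta>\<^sup>2 / 4) \<le> real n * (\<delta>\<^sup>2 / 4)"
        using K(2) by (intro mult_right_mono) auto
      then show ?thesis by (simp add: algebra_simps)
    qed
    finally show ?thesis .
  qed
  show "prob {\<omega> \<in> space M. \<delta> * real n \<le> (\<Sum>k\<in>K. G (u k) \<omega> * G (v k) \<omega>)} \<le> exp (- (\<delta>\<^sup>2 / 4 * real n))"
    using signed[of 1] by simp
  let ?S = "\<lambda>\<omega>. \<Sum>k\<in>K. G (u k) \<omega> * G (v k) \<omega>"
  have [measurable]: "random_variable borel ?S"
    using u(2) v(2) by (intro borel_measurable_sum borel_measurable_times rv) auto
  let ?E = "\<lambda>s. {\<omega> \<in> space M. \<delta> * real n \<le> s * ?S \<omega>}"
  have abs: "{\<omega> \<in> space M. \<delta> * real n \<le> \<bar>?S \<omega>\<bar>} = ?E 1 \<union> ?E (- 1)"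
    by (auto simp: abs_if split: if_splits)
  have "prob (?E 1 \<union> ?E (- 1)) \<le> prob (?E 1) + prob (?E (- 1))"
    by (intro measure_Un_le) measurable
  moreover have "prob (?E 1) \<le> exp (- (\<delta>\<^sup>2 / 4 * real n))" by (rule signed) simp
  moreover have "prob (?E (- 1)) \<le> exp (- (\<delta>\<^sup>2 / 4 * real n))" by (rule signed) simp
  ultimately show "prob {\<omega> \<in> space M. \<delta> * real n \<le> \<bar>?S \<omega>\<bar>} \<le> 2 * exp (- (\<delta>\<^sup>2 / 4 * real n))"
    unfolding abs by linarith
qed

text \<open>Chernoff with parameter 1/4. Only values above the threshold contribute, so the
  logarithmic moment per term is exponentially small in \<theta>.\<close>

lemma gaussian_excess_tail:
  assumes K: "finite K" "card K \<le> n" and u: "inj_on u K" "u ` K \<subseteq> L"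
  shows "prob {\<omega> \<in> space M. \<tau> * real n \<le> (\<Sum>k\<in>K. max 0 ((G (u k) \<omega>)\<^sup>2 - \<theta>))} \<le>
    exp ((2 * exp (- (\<theta> / 4)) - \<tau> / 4) * real n)"
proof -
  let ?Y = "\<lambda>k \<omega>. max 0 ((G (u k) \<omega>)\<^sup>2 - \<theta>) / 4"
  have indY: "indep_vars (\<lambda>_. borel) ?Y K"
    using indep_vars_compose2[OF indep_vars_reindex_inj[OF ind u], of "\<lambda>_ x. max 0 (x\<^sup>2 - \<theta>) / 4"]
    by simp
  have mgf: "(\<integral>\<^sup>+\<omega>. ennreal (exp (?Y k \<omega>)) \<partial>M) \<le> ennreal (exp (2 * exp (- (\<theta> / 4))))" if "k \<in> K" for k
  proof -
    have rv[measurable]: "random_variable borel (G (u k))"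
      using ind u(2) that by (auto simp: indep_vars_def)
    have plus: "1 + ennreal a * ennreal b = ennreal (1 + a * b)" if "0 \<le> a" "0 \<le> b" for a b
      using that by (subst ennreal_plus) (auto simp: ennreal_mult')
    have "(\<integral>\<^sup>+\<omega>. ennreal (exp (?Y k \<omega>)) \<partial>M) \<le>
        (\<integral>\<^sup>+\<omega>. 1 + ennreal (exp (- (\<theta> / 4))) * ennreal (exp (1 / 4 * (G (u k) \<omega>)\<^sup>2)) \<partial>M)"
    proof (rule nn_integral_mono)
      fix \<omega>
      \<comment> \<open>Replaces the truncation by a sum, since
        \<open>exp (max 0 t) \<le> 1 + exp t\<close>; what remains is a plain exponential moment of
        a squared Gaussian, equal to the square root of 2.\<close>
      have "exp (?Y k \<omega>) \<le> 1 + exp (((G (u k) \<omega>)\<^sup>2 - \<theta>) / 4)"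
        by (auto simp: max_def)
      also have "exp (((G (u k) \<omega>)\<^sup>2 - \<theta>) / 4) = exp (- (\<theta> / 4)) * exp (1 / 4 * (G (u k) \<omega>)\<^sup>2)"
        by (simp add: diff_divide_distrib flip: exp_add)
      finally show "ennreal (exp (?Y k \<omega>)) \<le>
          1 + ennreal (exp (- (\<theta> / 4))) * ennreal (exp (1 / 4 * (G (u k) \<omega>)\<^sup>2))"
        unfolding plus[OF exp_ge_zero exp_ge_zero] by (rule ennreal_leI)
    qed
    also have "\<dots> = 1 + ennreal (exp (- (\<theta> / 4))) * (\<integral>\<^sup>+\<omega>. ennreal (exp (1 / 4 * (G (u k) \<omega>)\<^sup>2)) \<partial>M)"
      by (subst nn_integral_add) (auto simp: nn_integral_cmult emeasure_space_1)
    also have "(\<integral>\<^sup>+\<omega>. ennreal (exp (1 / 4 * (G (u k) \<omega>)\<^sup>2)) \<partial>M) = ennreal (1 / sqrt (1 / 2))"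
      using nn_integral_std_normal_exp_square[of "1 / 4"]
        distributed_nn_integral[OF std, of "u k" "\<lambda>x. ennreal (exp (1 / 4 * x\<^sup>2))"] that u(2)
      by auto
    also have "1 + ennreal (exp (- (\<theta> / 4))) * ennreal (1 / sqrt (1 / 2)) =
        ennreal (1 + exp (- (\<theta> / 4)) * (1 / sqrt (1 / 2)))"
      by (rule plus) auto
    also have "\<dots> \<le> ennreal (exp (2 * exp (- (\<theta> / 4))))"
    proof (rule ennreal_leI)
      have "(1 / 2 :: real) \<le> sqrt (1 / 2)" by (rule real_le_rsqrt) (simp add: power2_eq_square)
      then have "1 / sqrt (1 / 2) \<le> (2 :: real)" by (simp add: field_simps)
      then have "1 + exp (- (\<theta> / 4)) * (1 / sqrt (1 / 2)) \<le> 1 + exp (- (\<theta> / 4)) * 2"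
        by (intro add_left_mono mult_left_mono) auto
      also have "\<dots> \<le> exp (2 * exp (- (\<theta> / 4)))"
        using exp_ge_add_one_self[of "2 * exp (- (\<theta> / 4))"] by (simp add: mult.commute)
      finally show "1 + exp (- (\<theta> / 4)) * (1 / sqrt (1 / 2)) \<le> exp (2 * exp (- (\<theta> / 4)))" .
    qed
    finally show ?thesis .
  qed
  have "{\<omega> \<in> space M. \<tau> * real n \<le> (\<Sum>k\<in>K. max 0 ((G (u k) \<omega>)\<^sup>2 - \<theta>))} =
      {\<omega> \<in> space M. \<tau> / 4 * real n \<le> (\<Sum>k\<in>K. ?Y k \<omega>)}"
    by (auto simp flip: sum_divide_distrib)
  then have "prob {\<omega> \<in> space M. \<tau> * real n \<le> (\<Sum>k\<in>K. max 0 ((G (u k) \<omega>)\<^sup>2 - \<theta>))} \<le>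
      exp (real (card K) * (2 * exp (- (\<theta> / 4))) - \<tau> / 4 * real n)"
    using chernoff_bound[OF K(1) indY mgf] by presburger
  also have "\<dots> \<le> exp ((2 * exp (- (\<theta> / 4)) - \<tau> / 4) * real n)"
  proof -
    have "real (card K) * (2 * exp (- (\<theta> / 4))) \<le> real n * (2 * exp (- (\<theta> / 4)))"
      using K(2) by (intro mult_right_mono) auto
    then show ?thesis by (simp add: algebra_simps)
  qed
  finally show ?thesis .
qed

end

end

section \<open>The correlated Wigner model\<close>

text \<open>The upper-triangular representative of an unordered pair, so that both symmetric
  positions name the same random variable.\<close>

definition edge :: "nat \<Rightarrow> nat \<Rightarrow> nat \<times> nat" where
  "edge i k = (min i k, max i k)"

text \<open>The diagonal is left out: its variance differs, and \<open>off_diagonal\<close> erases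
  it.\<close>

definition strict_upper_indices :: "nat \<Rightarrow> (nat \<times> nat) set" where
  "strict_upper_indices n = {(i, j). i < j \<and> j < n}"

lemma edge_commute: "edge i k = edge k i"
  by (simp add: edge_def min.commute max.commute)

lemma edge_eq_iff: "edge i k = edge j l \<longleftrightarrow> i = j \<and> k = l \<or> i = l \<and> k = j"
  by (auto simp: edge_def min_def max_def)

lemma edge_in_strict_upper_indices: "i < n \<Longrightarrow> k < n \<Longrightarrow> i \<noteq> k \<Longrightarrow> edge i k \<in> strict_upper_indices n"
  by (auto simp: edge_def strict_upper_indices_def)

text \<open>Puts \<open>A\<close> (tag \<open>False\<close>) and its independent copy
  \<open>Z\<close> (tag \<open>True\<close>) into one independent family of standard Gaussians, the
  form that the tail bounds expect.\<close>

lemma (in prob_space) correlated_wigner_standard_family: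
  assumes "correlated_gaussian_wigner n \<sigma> A B" "1 \<le> n"
  shows "\<exists>Z. gaussian_wigner n A \<and> gaussian_wigner n Z \<and>
    (\<forall>\<omega> \<in> space M. B \<omega> = sqrt (1 - \<sigma>\<^sup>2) \<cdot>\<^sub>m A \<omega> + \<sigma> \<cdot>\<^sub>m Z \<omega>) \<and>
    indep_vars (\<lambda>_. borel) (\<lambda>(b, q) \<omega>. sqrt (real n) * (if b then Z \<omega> else A \<omega>) $$ q)
      (UNIV \<times> strict_upper_indices n) \<and>
    (\<forall>l \<in> UNIV \<times> strict_upper_indices n. distributed M lborel
      ((\<lambda>(b, q) \<omega>. sqrt (real n) * (if b then Z \<omega> else A \<omega>) $$ q) l) std_normal_density)"
proof -
  obtain Z where A: "gaussian_wigner n A" and Z: "gaussian_wigner n Z"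
    and ind: "indep_var
          (PiM (upper_indices n) (\<lambda>_. borel)) (\<lambda>\<omega>. \<lambda>q \<in> upper_indices n. A \<omega> $$ q)
          (PiM (upper_indices n) (\<lambda>_. borel)) (\<lambda>\<omega>. \<lambda>q \<in> upper_indices n. Z \<omega> $$ q)"
    and B: "\<forall>\<omega> \<in> space M. B \<omega> = sqrt (1 - \<sigma>\<^sup>2) \<cdot>\<^sub>m A \<omega> + \<sigma> \<cdot>\<^sub>m Z \<omega>"
    using assms(1) unfolding correlated_gaussian_wigner_def by blast
  have fin: "finite (upper_indices n)"
    by (rule finite_subset[of _ "{..<n} \<times> {..<n}"]) (auto simp: upper_indices_def)
  have ne: "upper_indices n \<noteq> {}" using assms(2) by (force simp: upper_indices_def)
  have sub: "strict_upper_indices n \<subseteq> upper_indices n"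
    by (auto simp: strict_upper_indices_def upper_indices_def)
  let ?W = "\<lambda>(b, q) \<omega>. sqrt (real n) * (if b then Z \<omega> else A \<omega>) $$ q"
  \<comment> \<open>The families are merged on \<open>upper_indices n\<close>, where joint
    independence is given and which is nonempty; the strict triangle is empty for
    \<open>n = 1\<close>, so restriction comes afterwards.\<close>
  have "indep_vars (\<lambda>_. borel) (\<lambda>(b, q). if b then (\<lambda>\<omega>. Z \<omega> $$ q) else (\<lambda>\<omega>. A \<omega> $$ q))
      (UNIV \<times> upper_indices n)"
    using A Z by (intro indep_vars_bool_Times fin ne ind) (simp_all add: gaussian_wigner_def)
  then have "indep_vars (\<lambda>_. borel) (\<lambda>(b, q). if b then (\<lambda>\<omega>. Z \<omega> $$ q) else (\<lambda>\<omega>. A \<omega> $$ q))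
      (UNIV \<times> strict_upper_indices n)"
    by (rule indep_vars_subset) (use sub in auto)
  then have "indep_vars (\<lambda>_. borel)
      (\<lambda>l \<omega>. sqrt (real n) * (case l of (b, q) \<Rightarrow> if b then (\<lambda>\<omega>. Z \<omega> $$ q) else (\<lambda>\<omega>. A \<omega> $$ q)) \<omega>)
      (UNIV \<times> strict_upper_indices n)"
    by (rule indep_vars_compose2) simp
  moreover have "(\<lambda>l \<omega>. sqrt (real n) * (case l of (b, q) \<Rightarrow> if b then (\<lambda>\<omega>. Z \<omega> $$ q) else (\<lambda>\<omega>. A \<omega> $$ q)) \<omega>) = ?W"
    by (auto simp: fun_eq_iff)
  ultimately have indW: "indep_vars (\<lambda>_. borel) ?W (UNIV \<times> strict_upper_indices n)" by simp
  have "distributed M lborel (?W l) std_normal_density" if l_in: "l \<in> UNIV \<times> strict_upper_indices n" for l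
  proof -
    obtain b i j where l: "l = (b, (i, j))" "i < j" "j < n"
      using l_in by (auto simp: strict_upper_indices_def)
    have dist: "distributed M lborel (\<lambda>\<omega>. (if b then Z \<omega> else A \<omega>) $$ (i, j))
        (normal_density 0 (sqrt (1 / real n)))"
      using A Z l(2,3) by (cases b) (auto simp: gaussian_wigner_def)
    have "0 < sqrt (1 / real n)" using assms(2) by simp
    from normal_standard_normal_convert[OF this, THEN iffD1, OF dist]
    show ?thesis by (simp add: l(1) real_sqrt_divide mult.commute)
  qed
  then show ?thesis using A Z B indW by blast
qed

text \<open>Fits the rate of \<open>gaussian_excess_tail\<close> at level \<rho>/24 to the common
  rate. The threshold beats \<rho> because the fourth power of
  \<open>5 / \<rho> \<le> exp (5 / \<rho>)\<close> yields
  \<open>exp (- (20 / \<rho>)) \<le> \<rho> / 625\<close>.\<close>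

lemma exp_tail_constant:
  fixes \<rho> :: real
  assumes "0 < \<rho>" "\<rho> \<le> 1" "80 / \<rho> \<le> \<theta>"
  shows "2 * exp (- (\<theta> / 4)) - \<rho> / 96 \<le> - (\<rho>\<^sup>2 / 4096)"
proof -
  have "exp (- (\<theta> / 4)) \<le> exp (- (20 / \<rho>))" using assms by simp
  also have "\<dots> \<le> \<rho> / 625"
  proof -
    have "625 / \<rho> \<le> 625 / \<rho> ^ 4"
      using assms power_le_one[of \<rho> 3] by (simp add: field_simps power_numeral_reduce)
    also have "\<dots> = (5 / \<rho>) ^ 4" by (simp add: power_divide)
    also have "\<dots> \<le> exp (5 / \<rho>) ^ 4"
      using assms(1) order_trans[OF _ exp_ge_add_one_self, of "5 / \<rho>" "5 / \<rho>"] by (intro power_mono) auto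
    also have "\<dots> = exp (20 / \<rho>)" by (simp flip: exp_of_nat_mult)
    finally show ?thesis using assms(1) by (simp add: exp_minus field_simps)
  qed
  finally have "exp (- (\<theta> / 4)) \<le> \<rho> / 625" .
  moreover have "\<rho>\<^sup>2 \<le> \<rho>" using assms by (simp add: power2_eq_square)
  ultimately show ?thesis using assms(1) by argo
qed

text \<open>A union bound over four families of exceptional events; outside them
  \<open>row_dominance\<close> holds simultaneously for all admissible permutations and all pairs of
  columns.\<close>

lemma (in prob_space) ppmgm_success_prob:
  assumes corr: "correlated_gaussian_wigner n \<sigma> A B"
    and \<sigma>: "0 \<le> \<sigma>" "\<sigma> < 1" and \<kappa>: "\<kappa> = (9 / 410)\<^sup>2 * (1 - \<sigma>\<^sup>2)" and "1 \<le> n" "0 < N"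
  shows "measure M {\<omega> \<in> space M.
         \<forall>X0 \<in> permutation_mats n. real (card (fixed_points X0)) \<ge> (1 - \<kappa>) * real n \<longrightarrow>
           (\<forall>X \<in> ppmgm (off_diagonal (A \<omega>)) (off_diagonal (B \<omega>)) X0 N. X = 1\<^sub>m n)}
       \<ge> 1 - 14 * (real n)\<^sup>2 * exp (- ((1 - \<sigma>\<^sup>2) / 4096) * real n)"
proof -
  define \<rho> where "\<rho> = sqrt (1 - \<sigma>\<^sup>2)"
  have "\<sigma>\<^sup>2 < 1" using \<sigma> by (simp add: power_less_one_iff)
  then have \<rho>: "0 < \<rho>" "\<rho> \<le> 1" "\<rho>\<^sup>2 + \<sigma>\<^sup>2 = 1" "\<rho>\<^sup>2 = 1 - \<sigma>\<^sup>2" by (auto simp: \<rho>_def)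
  have \<rho>1: "\<rho>\<^sup>2 \<le> 1" using \<rho>(1,2) by (simp add: power_le_one)
  \<comment> \<open>The largest threshold allowed by \<open>row_dominance\<close>. With the given
    \<kappa> it is about 86/\<rho>, just above the 80/\<rho> that the excess tail requires; this is
    where the constant 9/410 enters.\<close>
  define \<theta> where "\<theta> = \<rho> / (24 * \<kappa>)"
  have \<kappa>': "\<kappa> = (9 / 410)\<^sup>2 * \<rho>\<^sup>2" using \<kappa> \<rho>(4) by simp
  then have "0 < \<kappa>" using \<rho>(1) by simp
  then have \<theta>: "0 \<le> \<theta>" "\<kappa> * \<theta> \<le> \<rho> / 24" using \<rho>(1) by (auto simp: \<theta>_def)
  have \<theta>80: "80 / \<rho> \<le> \<theta>"
    using \<rho>(1) by (simp add: \<theta>_def \<kappa>' power2_eq_square field_simps)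
  obtain Z where A: "gaussian_wigner n A" and Z: "gaussian_wigner n Z"
    and B: "\<forall>\<omega> \<in> space M. B \<omega> = \<rho> \<cdot>\<^sub>m A \<omega> + \<sigma> \<cdot>\<^sub>m Z \<omega>"
    and ind: "indep_vars (\<lambda>_. borel) (\<lambda>(b, q) \<omega>. sqrt (real n) * (if b then Z \<omega> else A \<omega>) $$ q)
      (UNIV \<times> strict_upper_indices n)"
    and std: "\<forall>l \<in> UNIV \<times> strict_upper_indices n. distributed M lborel
      ((\<lambda>(b, q) \<omega>. sqrt (real n) * (if b then Z \<omega> else A \<omega>) $$ q) l) std_normal_density"
    using correlated_wigner_standard_family[OF corr \<open>1 \<le> n\<close>, folded \<rho>_def] by blast
  define G where "G = (\<lambda>(b, q) \<omega>. sqrt (real n) * (if b then Z \<omega> else A \<omega>) $$ q)"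
  let ?L = "UNIV \<times> strict_upper_indices n"
  note ind = ind[folded G_def] and std = std[folded G_def, rule_format]
  have rv: "random_variable borel (G l)" if "l \<in> ?L" for l
    using ind that by (auto simp: indep_vars_def)
  \<comment> \<open>Rescaled off-diagonal entries of \<open>A\<close> or \<open>Z\<close>. Reading
    them through \<open>edge\<close> gives symmetry for all indices without a range condition, as
    \<open>row_dominance\<close> demands.\<close>
  define e where "e b i k \<omega> = (if i = k then 0 else G (b, edge i k) \<omega>)" for b i k \<omega>
  have rv_e: "random_variable borel (e b i k)" if "i < n" "k < n" for b i k
  proof -
    have "e b i k = (if i = k then (\<lambda>_. 0) else G (b, edge i k))" by (auto simp: e_def fun_eq_iff)
    then show ?thesis using rv[of "(b, edge i k)"] edge_in_strict_upper_indices[OF that] by simp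
  qed
  have e_sym: "e b i k \<omega> = e b k i \<omega>" for b i k \<omega>
    unfolding e_def edge_commute[of i k] by auto
  have carrier: "A \<omega> \<in> carrier_mat n n" "Z \<omega> \<in> carrier_mat n n" "B \<omega> \<in> carrier_mat n n"
    if "\<omega> \<in> space M" for \<omega>
    using that A Z B by (auto simp: gaussian_wigner_def)
  have symm: "A \<omega> $$ (i, k) = A \<omega> $$ (k, i)" "Z \<omega> $$ (i, k) = Z \<omega> $$ (k, i)"
    if "\<omega> \<in> space M" "i < n" "k < n" for \<omega> i k
  proof -
    have "transpose_mat (A \<omega>) $$ (k, i) = A \<omega> $$ (i, k)" "transpose_mat (Z \<omega>) $$ (k, i) = Z \<omega> $$ (i, k)"
      using carrier[OF that(1)] that(2,3) by auto
    then show "A \<omega> $$ (i, k) = A \<omega> $$ (k, i)" "Z \<omega> $$ (i, k) = Z \<omega> $$ (k, i)"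
      using A Z that(1) by (auto simp: gaussian_wigner_def)
  qed
  have e_eq: "e b i k \<omega> = sqrt (real n) * off_diagonal (if b then Z \<omega> else A \<omega>) $$ (i, k)"
    if "\<omega> \<in> space M" "i < n" "k < n" for b i k \<omega>
    using carrier[OF that(1)] that symm[OF that]
    by (auto simp: e_def G_def edge_def off_diagonal_def min_def max_def)
  have e_A: "off_diagonal (A \<omega>) $$ (i, k) = e False i k \<omega> / sqrt (real n)"
    if "\<omega> \<in> space M" "i < n" "k < n" for i k \<omega>
    using e_eq[OF that, of False] \<open>1 \<le> n\<close> by simp
  have e_B: "off_diagonal (B \<omega>) $$ (i, k) = (\<rho> * e False i k \<omega> + \<sigma> * e True i k \<omega>) / sqrt (real n)"
    if "\<omega> \<in> space M" "i < n" "k < n" for i k \<omega>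
  proof -
    have "off_diagonal (B \<omega>) $$ (i, k) =
        \<rho> * off_diagonal (A \<omega>) $$ (i, k) + \<sigma> * off_diagonal (Z \<omega>) $$ (i, k)"
      using B carrier[OF that(1)] that by (simp add: off_diagonal_def)
    then show ?thesis
      using e_eq[OF that, of False] e_eq[OF that, of True] \<open>1 \<le> n\<close> by (simp add: add_divide_distrib)
  qed

  \<comment> \<open>A common bound for all events. The rate is that of the cross terms in
    \<open>E3\<close>, where
    \<open>(\<rho> / 32)\<^sup>2 / 4 = \<rho>\<^sup>2 / 4096\<close>.\<close>
  define p where "p = 2 * exp (- (\<rho>\<^sup>2 / 4096 * real n))"
  define E1 where "E1 i = {\<omega> \<in> space M. (\<Sum>k<n. (e False i k \<omega>)\<^sup>2) \<le> 3 / 4 * real n}" for i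
  \<comment> \<open>Putting \<open>i \<noteq> j\<close> inside the event makes it empty on the
    diagonal, so the union can run over the full square.\<close>
  define E2 where "E2 = (\<lambda>(i, j). {\<omega> \<in> space M. i \<noteq> j \<and>
      1 / 16 * real n \<le> (\<Sum>k<n. e False i k \<omega> * e False j k \<omega>)})"
  define E3 where "E3 = (\<lambda>(i, j). {\<omega> \<in> space M.
      \<rho> / 32 * real n \<le> \<bar>\<Sum>k<n. e False i k \<omega> * e True j k \<omega>\<bar>})"
  define E4 where "E4 = (\<lambda>(b, i). {\<omega> \<in> space M.
      \<rho> / 24 * real n \<le> (\<Sum>k<n. max 0 ((e b i k \<omega>)\<^sup>2 - \<theta>))})"
  have row: "inj_on (\<lambda>k. (b, edge i k)) ({..<n} - S)" "(\<lambda>k. (b, edge i k)) ` ({..<n} - S) \<subseteq> ?L"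
    if "i < n" "i \<in> S" for b i S
  proof -
    show "inj_on (\<lambda>k. (b, edge i k)) ({..<n} - S)" by (auto simp: inj_on_def edge_eq_iff)
    show "(\<lambda>k. (b, edge i k)) ` ({..<n} - S) \<subseteq> ?L"
      by (intro image_subsetI SigmaI UNIV_I edge_in_strict_upper_indices) (use that in auto)
  qed
  have sum_rv: "random_variable borel (\<lambda>\<omega>. \<Sum>k<n. (e b i k \<omega>)\<^sup>2)"
    "random_variable borel (\<lambda>\<omega>. \<Sum>k<n. e b i k \<omega> * e b' j k \<omega>)"
    "random_variable borel (\<lambda>\<omega>. \<Sum>k<n. max 0 ((e b i k \<omega>)\<^sup>2 - \<theta>))"
    if "i < n" "j < n" for b b' i j
    using that by (intro borel_measurable_sum borel_measurable_power borel_measurable_times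
      borel_measurable_max borel_measurable_const borel_measurable_diff rv_e; simp)+
  have ev1: "E1 i \<in> events" and ev4: "E4 (b, i) \<in> events" if i: "i < n" for b i
  proof -
    note sum_rv[OF i i, measurable]
    show "E1 i \<in> events" unfolding E1_def by measurable
    show "E4 (b, i) \<in> events" unfolding E4_def split_conv by measurable
  qed
  have ev2: "E2 (i, j) \<in> events" and ev3: "E3 (i, j) \<in> events" if ij: "i < n" "j < n" for i j
  proof -
    note sum_rv[OF ij, measurable]
    show "E2 (i, j) \<in> events" unfolding E2_def split_conv by measurable
    show "E3 (i, j) \<in> events" unfolding E3_def split_conv by measurable
  qed
  have "prob (E1 i) \<le> p" if i: "i < n" for i
  proof -
    have "(\<Sum>k<n. (e False i k \<omega>)\<^sup>2) = (\<Sum>k\<in>{..<n} - {i}. (G (False, edge i k) \<omega>)\<^sup>2)" for \<omega>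
      by (rule sum.mono_neutral_cong_right) (auto simp: e_def)
    moreover have "prob {\<omega> \<in> space M. (\<Sum>k\<in>{..<n} - {i}. (G (False, edge i k) \<omega>)\<^sup>2) \<le> 3 / 4 * real n} \<le>
        2 * exp (- (real n / 320))"
      by (rule gaussian_square_sum_lower_tail[OF ind std])
         (use row[OF i, of "{i}" False] i in simp_all)
    ultimately have "prob (E1 i) \<le> 2 * exp (- (real n / 320))" by (simp add: E1_def)
    also have "\<dots> \<le> p"
    proof -
      have "\<rho>\<^sup>2 / 4096 \<le> 1 / 320" using \<rho>1 by simp
      then show ?thesis using mult_right_mono[of "\<rho>\<^sup>2 / 4096" "1 / 320" "real n"] by (simp add: p_def)
    qed
    finally show ?thesis .
  qed
  then have P1: "prob (\<Union>i\<in>{..<n}. E1 i) \<le> real (card {..<n}) * p"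
    by (intro prob_UN_le_card) (auto intro: ev1)
  have "prob (E2 (i, j)) \<le> p" if ij: "i < n" "j < n" for i j
  proof (cases "i = j")
    case False
    \<comment> \<open>The terms at \<open>i\<close> and \<open>j\<close> vanish, and dropping them
      removes the edge between \<open>i\<close> and \<open>j\<close>, the only one shared by the two
      rows.\<close>
    let ?K = "{..<n} - {i, j}"
    have "(\<Sum>k<n. e False i k \<omega> * e False j k \<omega>) =
        (\<Sum>k\<in>?K. G (False, edge i k) \<omega> * G (False, edge j k) \<omega>)" for \<omega>
      by (rule sum.mono_neutral_cong_right) (auto simp: e_def)
    moreover have "prob {\<omega> \<in> space M. 1 / 16 * real n \<le>
        (\<Sum>k\<in>?K. G (False, edge i k) \<omega> * G (False, edge j k) \<omega>)} \<le> exp (- ((1 / 16)\<^sup>2 / 4 * real n))"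
    proof (rule gaussian_inner_product_tail(1)[OF ind std])
      show "card ?K \<le> n" using card_mono[of "{..<n}" ?K] by auto
      show "(\<lambda>k. (False, edge i k)) ` ?K \<inter> (\<lambda>k. (False, edge j k)) ` ?K = {}"
        using False by (auto simp: edge_eq_iff)
    qed (use row[OF ij(1), of "{i, j}"] row[OF ij(2), of "{i, j}"] in simp_all)
    ultimately have "prob (E2 (i, j)) \<le> exp (- ((1 / 16)\<^sup>2 / 4 * real n))"
      using False by (simp add: E2_def)
    also have "\<dots> \<le> exp (- (\<rho>\<^sup>2 / 4096 * real n))"
      using mult_right_mono[of "\<rho>\<^sup>2 / 4096" "1 / 1024" "real n"] \<rho>1 by (simp add: power2_eq_square)
    also have "\<dots> \<le> p" by (simp add: p_def)
    finally show ?thesis .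
  qed (simp add: E2_def p_def)
  then have P2: "prob (\<Union>q\<in>{..<n} \<times> {..<n}. E2 q) \<le> real (card ({..<n} \<times> {..<n})) * p"
    by (intro prob_UN_le_card) (auto intro: ev2)
  have "prob (E3 (i, j)) \<le> p" if ij: "i < n" "j < n" for i j
  proof -
    let ?K = "{..<n} - {i, j}"
    have "(\<Sum>k<n. e False i k \<omega> * e True j k \<omega>) =
        (\<Sum>k\<in>?K. G (False, edge i k) \<omega> * G (True, edge j k) \<omega>)" for \<omega>
      by (rule sum.mono_neutral_cong_right) (auto simp: e_def)
    moreover have "prob {\<omega> \<in> space M. \<rho> / 32 * real n \<le>
        \<bar>\<Sum>k\<in>?K. G (False, edge i k) \<omega> * G (True, edge j k) \<omega>\<bar>} \<le> 2 * exp (- ((\<rho> / 32)\<^sup>2 / 4 * real n))"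
    proof (rule gaussian_inner_product_tail(2)[OF ind std])
      show "card ?K \<le> n" using card_mono[of "{..<n}" ?K] by auto
      \<comment> \<open>The tags separate \<open>A\<close> from \<open>Z\<close>, so the case
        \<open>i = j\<close> is covered as well.\<close>
      show "(\<lambda>k. (False, edge i k)) ` ?K \<inter> (\<lambda>k. (True, edge j k)) ` ?K = {}" by auto
    qed (use row[OF ij(1), of "{i, j}"] row[OF ij(2), of "{i, j}"] \<rho>(1,2) in simp_all)
    ultimately have "prob (E3 (i, j)) \<le> 2 * exp (- ((\<rho> / 32)\<^sup>2 / 4 * real n))"
      by (simp add: E3_def)
    then show ?thesis by (simp add: p_def power_divide)
  qed
  then have P3: "prob (\<Union>q\<in>{..<n} \<times> {..<n}. E3 q) \<le> real (card ({..<n} \<times> {..<n})) * p"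
    by (intro prob_UN_le_card) (auto intro: ev3)
  have "prob (E4 (b, i)) \<le> p" if i: "i < n" for b i
  proof -
    have "(\<Sum>k<n. max 0 ((e b i k \<omega>)\<^sup>2 - \<theta>)) =
        (\<Sum>k\<in>{..<n} - {i}. max 0 ((G (b, edge i k) \<omega>)\<^sup>2 - \<theta>))" for \<omega>
      using \<theta>(1) by (intro sum.mono_neutral_cong_right) (auto simp: e_def)
    moreover have "prob {\<omega> \<in> space M. \<rho> / 24 * real n \<le>
        (\<Sum>k\<in>{..<n} - {i}. max 0 ((G (b, edge i k) \<omega>)\<^sup>2 - \<theta>))} \<le>
        exp ((2 * exp (- (\<theta> / 4)) - \<rho> / 24 / 4) * real n)"
      by (rule gaussian_excess_tail[OF ind std]) (use row[OF i, of "{i}"] i in simp_all)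
    ultimately have "prob (E4 (b, i)) \<le> exp ((2 * exp (- (\<theta> / 4)) - \<rho> / 24 / 4) * real n)"
      by (simp add: E4_def)
    also have "\<dots> \<le> exp (- (\<rho>\<^sup>2 / 4096) * real n)"
      using mult_right_mono[OF exp_tail_constant[OF \<rho>(1,2) \<theta>80], of "real n"] by simp
    also have "\<dots> \<le> p" by (simp add: p_def)
    finally show ?thesis .
  qed
  then have P4: "prob (\<Union>q\<in>UNIV \<times> {..<n}. E4 q) \<le> real (card ((UNIV :: bool set) \<times> {..<n})) * p"
    by (intro prob_UN_le_card) (auto intro: ev4)

  let ?U1 = "\<Union>i\<in>{..<n}. E1 i" and ?U2 = "\<Union>q\<in>{..<n} \<times> {..<n}. E2 q"
    and ?U3 = "\<Union>q\<in>{..<n} \<times> {..<n}. E3 q" and ?U4 = "\<Union>q\<in>UNIV \<times> {..<n}. E4 q"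
  have UE: "?U1 \<in> events" "?U2 \<in> events" "?U3 \<in> events" "?U4 \<in> events"
    using ev1 ev2 ev3 ev4 by (auto intro!: sets.finite_UN)
  define bad where "bad = ?U1 \<union> (?U2 \<union> (?U3 \<union> ?U4))"
  have bad: "bad \<in> events" unfolding bad_def using UE by blast
  have "prob bad \<le> prob ?U1 + (prob ?U2 + (prob ?U3 + prob ?U4))"
    unfolding bad_def using UE
    by (intro order.trans[OF measure_Un_le] add_left_mono sets.Un order_refl)
  also have "\<dots> \<le> real n * p + ((real n)\<^sup>2 * p + ((real n)\<^sup>2 * p + 2 * real n * p))"
    using P1 P2 P3 P4 by (intro add_mono) (simp_all add: card_cartesian_product power2_eq_square)
  \<comment> \<open>Together with the factor 2 in \<open>p\<close> this gives the 14 of the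
    conclusion.\<close>
  also have "\<dots> \<le> 7 * (real n)\<^sup>2 * p"
  proof -
    have "real n \<le> (real n)\<^sup>2" using \<open>1 \<le> n\<close> by (simp add: power2_eq_square)
    moreover have "0 \<le> (real n)\<^sup>2" by simp
    ultimately have "real n + (real n)\<^sup>2 + (real n)\<^sup>2 + 2 * real n \<le> 7 * (real n)\<^sup>2" by linarith
    moreover have "0 \<le> p" by (simp add: p_def)
    ultimately have "(real n + (real n)\<^sup>2 + (real n)\<^sup>2 + 2 * real n) * p \<le> 7 * (real n)\<^sup>2 * p"
      by (rule mult_right_mono)
    then show ?thesis by (simp add: algebra_simps)
  qed
  finally have prob_bad: "prob bad \<le> 7 * (real n)\<^sup>2 * p" .

  let ?S = "{\<omega> \<in> space M.
         \<forall>X0 \<in> permutation_mats n. real (card (fixed_points X0)) \<ge> (1 - \<kappa>) * real n \<longrightarrow>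
           (\<forall>X \<in> ppmgm (off_diagonal (A \<omega>)) (off_diagonal (B \<omega>)) X0 N. X = 1\<^sub>m n)}"
  have carrier_off: "off_diagonal (A \<omega>) \<in> carrier_mat n n" "off_diagonal (B \<omega>) \<in> carrier_mat n n"
    if "\<omega> \<in> space M" for \<omega>
    using carrier[OF that] by (auto simp: off_diagonal_def)
  have S: "?S \<in> events"
  proof (rule sets_ppmgm_all_eq)
    fix i j assume ij: "i < n" "j < n"
    have "random_variable borel (\<lambda>\<omega>. e False i j \<omega> / sqrt (real n))"
      by (intro borel_measurable_divide borel_measurable_const rv_e ij)
    then show "random_variable borel (\<lambda>\<omega>. off_diagonal (A \<omega>) $$ (i, j))"
      by (rule measurable_cong[THEN iffD1, rotated]) (simp add: e_A ij)
    have "random_variable borel (\<lambda>\<omega>. (\<rho> * e False i j \<omega> + \<sigma> * e True i j \<omega>) / sqrt (real n))"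
      by (intro borel_measurable_divide borel_measurable_add borel_measurable_times borel_measurable_const rv_e ij)
    then show "random_variable borel (\<lambda>\<omega>. off_diagonal (B \<omega>) $$ (i, j))"
      by (rule measurable_cong[THEN iffD1, rotated]) (simp add: e_B ij)
  qed (use carrier_off in auto)
  have "space M - bad \<subseteq> ?S"
  proof
    fix \<omega> assume "\<omega> \<in> space M - bad"
    then have \<omega>: "\<omega> \<in> space M" and
      g1: "\<And>i. i < n \<Longrightarrow> 3 / 4 * real n < (\<Sum>k<n. (e False i k \<omega>)\<^sup>2)" and
      g2: "\<And>i j. i < n \<Longrightarrow> j < n \<Longrightarrow> i \<noteq> j \<Longrightarrow> (\<Sum>k<n. e False i k \<omega> * e False j k \<omega>) < 1 / 16 * real n" and
      g3: "\<And>i j. i < n \<Longrightarrow> j < n \<Longrightarrow> \<bar>\<Sum>k<n. e False i k \<omega> * e True j k \<omega>\<bar> < \<rho> / 32 * real n" and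
      g4: "\<And>b i. i < n \<Longrightarrow> (\<Sum>k<n. max 0 ((e b i k \<omega>)\<^sup>2 - \<theta>)) < \<rho> / 24 * real n"
      by (auto simp: bad_def E1_def E2_def E3_def E4_def not_le)
    have step: "gmwm (off_diagonal (A \<omega>) * X * off_diagonal (B \<omega>)) \<subseteq> {1\<^sub>m n}"
      if X: "X \<in> permutation_mats n" "(1 - \<kappa>) * real n \<le> real (card (fixed_points X))" for X
    proof -
      obtain \<pi> where \<pi>: "\<pi> permutes {..<n}" and X_eq: "X = mat n n (\<lambda>(i, j). if j = \<pi> i then 1 else 0)"
        using X(1) by (auto simp: permutation_mats_def)
      have "fixed_points X = {..<n} - {k \<in> {..<n}. \<pi> k \<noteq> k}"
        by (auto simp: fixed_points_def X_eq)
      then have "card (fixed_points X) = n - card {k \<in> {..<n}. \<pi> k \<noteq> k}"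
        by (simp only:) (subst card_Diff_subset; auto)
      moreover have "card {k \<in> {..<n}. \<pi> k \<noteq> k} \<le> n"
        using card_mono[of "{..<n}" "{k \<in> {..<n}. \<pi> k \<noteq> k}"] by auto
      ultimately have T: "real (card {k \<in> {..<n}. \<pi> k \<noteq> k}) \<le> \<kappa> * real n"
        using X(2) by (simp add: of_nat_diff algebra_simps)
      let ?C = "off_diagonal (A \<omega>) * X * off_diagonal (B \<omega>)"
      have C: "?C $$ (i, j) =
          (\<Sum>k<n. e False i k \<omega> * (\<rho> * e False (\<pi> k) j \<omega> + \<sigma> * e True (\<pi> k) j \<omega>)) / real n"
        if "i < n" "j < n" for i j
      proof -
        have "\<pi> k < n" if "k < n" for k using permutes_in_image[OF \<pi>] that by auto
        then have "?C $$ (i, j) = (\<Sum>k<n. e False i k \<omega> / sqrt (real n) *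
            ((\<rho> * e False (\<pi> k) j \<omega> + \<sigma> * e True (\<pi> k) j \<omega>) / sqrt (real n)))"
          unfolding X_eq using that \<omega>
          by (subst sandwich_permutation_index[OF carrier_off[OF \<omega>] \<pi> that]) (simp add: e_A e_B)
        then show ?thesis by (simp add: sum_divide_distrib)
      qed
      have "?C $$ (i, j) < ?C $$ (i, i)" if ij: "i < n" "j < n" "i \<noteq> j" for i j
      proof -
        have "(\<Sum>k<n. e False i k \<omega> * (\<rho> * e False (\<pi> k) j \<omega> + \<sigma> * e True (\<pi> k) j \<omega>)) <
            (\<Sum>k<n. e False i k \<omega> * (\<rho> * e False (\<pi> k) i \<omega> + \<sigma> * e True (\<pi> k) i \<omega>))"
          by (rule row_dominance[where x = "\<lambda>i k. e False i k \<omega>" and z = "\<lambda>i k. e True i k \<omega>",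
              OF e_sym e_sym \<rho>(1) \<sigma>(1) \<rho>(3) \<theta> g1[OF ij(1)] g2[OF ij] g3[OF ij(1)] g4 g4 ij(1,2) \<pi> T])
        then show ?thesis using ij \<open>1 \<le> n\<close> by (simp add: C divide_strict_right_mono)
      qed
      moreover have "dim_row ?C = n" using carrier_off[OF \<omega>] by simp
      ultimately show ?thesis using gmwm_row_dominant[of ?C] by simp
    qed
    \<comment> \<open>At least one step is taken; the first one already reaches the identity and the
      others stay there.\<close>
    obtain m where m: "N = Suc m" using \<open>0 < N\<close> by (cases N) auto
    have "ppmgm (off_diagonal (A \<omega>)) (off_diagonal (B \<omega>)) X0 N \<subseteq> {1\<^sub>m n}"
      if "X0 \<in> permutation_mats n" "(1 - \<kappa>) * real n \<le> real (card (fixed_points X0))" for X0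
      unfolding m by (rule ppmgm_eq_one[OF step less_imp_le[OF \<open>0 < \<kappa>\<close>] that])
    then show "\<omega> \<in> ?S" using \<omega> by blast
  qed
  then have "prob (space M - bad) \<le> prob ?S" by (rule finite_measure_mono) (rule S)
  moreover have "prob (space M - bad) = 1 - prob bad" using bad by (rule prob_compl)
  ultimately show ?thesis using prob_bad by (simp add: p_def \<rho>(4))
qed

theorem theorem3:
  fixes \<sigma> \<kappa> :: real
  assumes "0 \<le> \<sigma>" and "\<sigma> < 1"
    and "\<kappa> = (9 / 410)\<^sup>2 * (1 - \<sigma>\<^sup>2)"
  shows "\<exists>C' > 0. \<exists>c > 0. \<forall>n \<ge> 1. real n \<ge> C' / \<kappa> * ln (real n) \<longrightarrow>
    (\<forall>(M :: 'a measure) A B.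
       prob_space M \<longrightarrow> prob_space.correlated_gaussian_wigner M n \<sigma> A B \<longrightarrow>
       measure M {\<omega> \<in> space M.
         \<forall>X0 \<in> permutation_mats n. real (card (fixed_points X0)) \<ge> (1 - \<kappa>) * real n \<longrightarrow>
           (\<forall>X \<in> ppmgm (off_diagonal (A \<omega>)) (off_diagonal (B \<omega>)) X0 (nat \<lceil>2 * ln (real n)\<rceil>).
              X = 1\<^sub>m n)}
       \<ge> 1 - exp (- c * \<kappa> * real n) - 3 / (real n)\<^sup>2)"
proof -
  define c0 where "c0 = (1 - \<sigma>\<^sup>2) / 4096"
  have "\<sigma>\<^sup>2 < 1" using assms(1,2) by (simp add: power_less_one_iff)
  then have pos: "0 < c0" "0 < \<kappa>" using assms(3) by (auto simp: c0_def)
  show ?thesis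
  \<comment> \<open>The ratio of \<kappa> to \<open>c0\<close> does not depend on \<sigma>, so both
    witnesses are absolute constants. They are chosen so that the assumption reads
    \<open>6 * ln n \<le> c0 / 2 * n\<close> and the final rate is \<open>c0 / 2\<close>.\<close>
  proof (rule exI[of _ "12 * \<kappa> / c0"], intro conjI exI[of _ "c0 / (2 * \<kappa>)"] allI impI)
    show "0 < 12 * \<kappa> / c0" "0 < c0 / (2 * \<kappa>)" using pos by auto
    fix n :: nat and M :: "'a measure" and A B
    assume "1 \<le> n" and large: "12 * \<kappa> / c0 / \<kappa> * ln (real n) \<le> real n"
      and M: "prob_space M" and corr: "prob_space.correlated_gaussian_wigner M n \<sigma> A B"
    let ?p = "measure M {\<omega> \<in> space M.
         \<forall>X0 \<in> permutation_mats n. real (card (fixed_points X0)) \<ge> (1 - \<kappa>) * real n \<longrightarrow>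
           (\<forall>X \<in> ppmgm (off_diagonal (A \<omega>)) (off_diagonal (B \<omega>)) X0 (nat \<lceil>2 * ln (real n)\<rceil>).
              X = 1\<^sub>m n)}"
    show "1 - exp (- (c0 / (2 * \<kappa>)) * \<kappa> * real n) - 3 / (real n)\<^sup>2 \<le> ?p"
    \<comment> \<open>For \<open>n = 1\<close> no iteration is performed, but the claimed bound is
      negative because 3 is subtracted.\<close>
    proof (cases "n = 1")
      case True
      have "1 - exp (- (c0 / (2 * \<kappa>)) * \<kappa> * real n) - 3 / (real n)\<^sup>2 \<le> 0"
        using exp_gt_zero[of "- (c0 / (2 * \<kappa>)) * \<kappa> * real n"] unfolding True by (simp del: exp_gt_zero)
      then show ?thesis using measure_nonneg order_trans by blast
    next
      case False
      then have n: "2 \<le> real n" using \<open>1 \<le> n\<close> by simp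
      then have "0 < ln (real n)" by simp
      then have "0 < nat \<lceil>2 * ln (real n)\<rceil>" by simp
      then have "1 - 14 * (real n)\<^sup>2 * exp (- c0 * real n) \<le> ?p"
        using prob_space.ppmgm_success_prob[OF M corr assms \<open>1 \<le> n\<close>] by (simp add: c0_def)
      moreover have "14 * (real n)\<^sup>2 * exp (- c0 * real n) \<le> exp (- (c0 / 2) * real n)"
      proof -
        \<comment> \<open>The prefactor is at most the sixth power of \<open>n\<close>, which half
          of the exponential decay absorbs.\<close>
        have "14 \<le> (2 :: real) ^ 4" by simp
        also have "\<dots> \<le> real n ^ 4" using n by (intro power_mono) auto
        finally have "14 * (real n)\<^sup>2 \<le> real n ^ 4 * (real n)\<^sup>2" by (intro mult_right_mono) auto
        also have "\<dots> = exp (6 * ln (real n))"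
          using n by (simp add: exp_of_nat_mult[of 6, simplified] flip: power_add)
        also have "\<dots> \<le> exp (c0 / 2 * real n)"
          using large pos by (simp add: field_simps)
        finally have "14 * (real n)\<^sup>2 * exp (- c0 * real n) \<le> exp (c0 / 2 * real n) * exp (- c0 * real n)"
          by (rule mult_right_mono) simp
        also have "\<dots> = exp (- (c0 / 2) * real n)" by (simp flip: exp_add)
        finally show ?thesis .
      qed
      moreover have "0 \<le> 3 / (real n)\<^sup>2" by simp
      moreover have eq: "- (c0 / (2 * \<kappa>)) * \<kappa> * real n = - (c0 / 2) * real n" using pos by simp
      ultimately show ?thesis unfolding eq by linarith
    qed
  qed
qed

end
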